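(* Let $P=\{p_1,\dots,p_t\}$ be a system of polynomials with complex coefficients in the variables $x_1,\dots,x_s$, and let $\hat{\mathbf{x}}\in\mathbb{C}^s$ be an isolated zero of $P$. Then the multiplicity $\dim\mathcal{D}_{\hat{\mathbf{x}}}(P)$ is identical to the intersection multiplicity of $P$ at $\hat{\mathbf{x}}$.
   Context: A zero $\hat{\mathbf{x}}$ of a system is isolated if there is a neighborhood of $\hat{\mathbf{x}}$ in $\mathbb{C}^s$ in which it is the only common zero of the system. Differential functionals. For $\mathbf{j}=(j_1,\dots,j_s)$ with nonnegative integer entries write $|\mathbf{j}|=j_1+\cdots+j_s$ and $$\partial_{\mathbf{j}}[\hat{\mathbf{x}}](f)=\frac{1}{j_1!\cdots j_s!}\,\frac{\partial^{|\mathbf{j}|}f}{\partial x_1^{j_1}\cdots\partial x_s^{j_s}}(\hat{\mathbf{x}});$$ by convention $\partial_{\mathbf{j}}[\hat{\mathbf{x}}]=0$ if some $j_i<0$. A differential functional at $\hat{\mathbf{x}}$ is a finite complex linear combination $c=\sum_{\mathbf{j}} c_{\mathbf{j}}\partial_{\mathbf{j}}[\hat{\mathbf{x}}]$ (a formal linear combination of the symbols $\partial_{\mathbf{j}}[\hat{\mathbf{x}}]$). For a system $F=\{f_1,\dots,f_t\}$ we write $c(F)=\{c(f_1),\dots,c(f_t)\}$. For $i=1,\dots,s$, the linear anti-differentiation map $\phi_i$ is defined by $\phi_i(\partial_{j_1\cdots j_s}[\hat{\mathbf{x}}])=\partial_{j_1'\cdots j_s'}[\hat{\mathbf{x}}]$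 with $j_i'=j_i-1$ and $j_\sigma'=j_\sigma$ for $\sigma\neq i$. Dual space. $\mathcal{D}^0_{\hat{\mathbf{x}}}(F)=\mathrm{span}\{\partial_{0\cdots0}[\hat{\mathbf{x}}]\}$ and, for $\alpha\ge1$, $$\mathcal{D}^\alpha_{\hat{\mathbf{x}}}(F)=\Big\{c=\sum_{|\mathbf{j}|\le\alpha}c_{\mathbf{j}}\partial_{\mathbf{j}}[\hat{\mathbf{x}}]\ :\ c(F)=\{0\},\ \phi_i(c)\in\mathcal{D}^{\alpha-1}_{\hat{\mathbf{x}}}(F)\ \text{for all } i=1,\dots,s\Big\}.$$ These subspaces are nested; if $\mathcal{D}^\gamma_{\hat{\mathbf{x}}}(F)=\mathcal{D}^{\gamma-1}_{\hat{\mathbf{x}}}(F)$ for some $\gamma\ge1$, the dual space is $\mathcal{D}_{\hat{\mathbf{x}}}(F)=\mathcal{D}^\gamma_{\hat{\mathbf{x}}}(F)$, i.e. the union of all the $\mathcal{D}^\alpha_{\hat{\mathbf{x}}}(F)$. The multiplicity of $F$ at $\hat{\mathbf{x}}$ is $\dim\mathcal{D}_{\hat{\mathbf{x}}}(F)$. Intersection multiplicity. After translating $\hat{\mathbf{x}}$ to the origin, let $\mathbb{C}\{x_1,\dots,x_s\}$ be the ring of power series converging in some neighborhood of $\mathbf{0}$. The local ring of $P$ at $\hat{\mathbf{x}}=\mathbf{0}$ is $\mathcal{A}=\mathbb{C}\{x_1,\dots,x_s\}/P\,\mathbb{C}\{x_1,\dots,x_s\}$, where $P\,\mathbb{C}\{x_1,\dots,x_s\}$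 is the ideal generated by $p_1,\dots,p_t$. The intersection multiplicity of $P$ at $\hat{\mathbf{x}}$ is $\dim_{\mathbb{C}}\mathcal{A}$. *)

theory Defs
  imports
    "HOL-Analysis.Analysis"
    "HOL-Library.Poly_Mapping"
    "HOL-Library.Extended_Nat"
    "HOL-Algebra.QuotRing"
    "Jordan_Normal_Form.Missing_VectorSpace"
begin

text \<open>
  The variables \<open>x\<^sub>1, \<dots>, x\<^sub>s\<close> are indexed by a finite type \<open>'n\<close> with \<open>CARD('n) = s\<close>, and
  points of \<open>s\<close>-dimensional complex space have type \<^typ>\<open>complex ^ 'n\<close>.
  A polynomial is the finitely supported family of its coefficients, and multiplication in
  \<^typ>\<open>('n \<Rightarrow>\<^sub>0 nat) \<Rightarrow>\<^sub>0 complex\<close> is multiplication of polynomials.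
\<close>

type_synonym 'n mindex = "'n \<Rightarrow>\<^sub>0 nat"
type_synonym 'n cpoly = "'n mindex \<Rightarrow>\<^sub>0 complex"

abbreviation lookup :: "('a \<Rightarrow>\<^sub>0 'b::zero) \<Rightarrow> 'a \<Rightarrow> 'b" where
  "lookup \<equiv> Poly_Mapping.lookup"

abbreviation keys :: "('a \<Rightarrow>\<^sub>0 'b::zero) \<Rightarrow> 'a set" where
  "keys \<equiv> Poly_Mapping.keys"

abbreviation single :: "'a \<Rightarrow> 'b \<Rightarrow> 'a \<Rightarrow>\<^sub>0 'b::zero" where
  "single \<equiv> Poly_Mapping.single"

definition monom_eval :: "'n::finite mindex \<Rightarrow> complex ^ 'n \<Rightarrow> complex" where
  "monom_eval m x = (\<Prod>i\<in>UNIV. (x $ i) ^ lookup m i)"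

definition poly_eval :: "'n::finite cpoly \<Rightarrow> complex ^ 'n \<Rightarrow> complex" where
  "poly_eval p x = (\<Sum>m\<in>keys p. lookup p m * monom_eval m x)"

definition zero_set :: "'n::finite cpoly set \<Rightarrow> (complex ^ 'n) set" where
  "zero_set P = {x. \<forall>p\<in>P. poly_eval p x = 0}"


section \<open>Differential functionals\<close>

text \<open>
  In \<open>partial_deriv\<close> the subtraction of exponents is truncated, but a monomial free of the
  variable \<open>x\<^sub>i\<close> has the factor \<open>of_nat (lookup m i) = 0\<close>.
\<close>

definition partial_deriv :: "'n \<Rightarrow> 'n cpoly \<Rightarrow> 'n cpoly" where
  "partial_deriv i p =
    (\<Sum>m\<in>keys p. single (m - single i 1)
                    (of_nat (lookup m i) * lookup p m))"

text \<open>
  \<open>iter_deriv j\<close> differentiates \<open>j\<^sub>i\<close> times with respect to each \<open>x\<^sub>i\<close>; the order is irrelevant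
  by \<open>comp_fun_commute_partial_deriv\<close> below, so that the fold is well defined.
\<close>

definition iter_deriv :: "'n::finite mindex \<Rightarrow> 'n cpoly \<Rightarrow> 'n cpoly" where
  "iter_deriv j p = Finite_Set.fold (\<lambda>i. partial_deriv i ^^ lookup j i) p UNIV"

definition diff_symbol_at :: "complex ^ 'n::finite \<Rightarrow> 'n mindex \<Rightarrow> 'n cpoly \<Rightarrow> complex" where
  "diff_symbol_at a j p = poly_eval (iter_deriv j p) a / (\<Prod>i\<in>UNIV. fact (lookup j i))"

text \<open>
  A differential functional is a formal linear combination of the symbols indexed by
  multi-indices, hence again a finitely supported family of coefficients.
\<close>

type_synonym 'n functional = "'n mindex \<Rightarrow>\<^sub>0 complex"

definition apply_functional :: "complex ^ 'n::finite \<Rightarrow> 'n functional \<Rightarrow> 'n cpoly \<Rightarrow> complex" where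
  "apply_functional a c p = (\<Sum>j\<in>keys c. lookup c j * diff_symbol_at a j p)"

definition anti_diff :: "'n \<Rightarrow> 'n functional \<Rightarrow> 'n functional" where
  "anti_diff i c =
    (\<Sum>j\<in>keys c. if lookup j i = 0 then 0
                 else single (j - single i 1) (lookup c j))"

definition mindex_size :: "'n::finite mindex \<Rightarrow> nat" where
  "mindex_size j = (\<Sum>i\<in>UNIV. lookup j i)"

primrec dual_space_upto :: "'n::finite cpoly set \<Rightarrow> complex ^ 'n \<Rightarrow> nat \<Rightarrow> 'n functional set" where
  "dual_space_upto P a 0 = {single 0 b | b. True}"
| "dual_space_upto P a (Suc \<alpha>) =
    {c. (\<forall>j\<in>keys c. mindex_size j \<le> Suc \<alpha>) \<and>
        (\<forall>p\<in>P. apply_functional a c p = 0) \<and>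
        (\<forall>i. anti_diff i c \<in> dual_space_upto P a \<alpha>)}"

definition dual_space :: "'n::finite cpoly set \<Rightarrow> complex ^ 'n \<Rightarrow> 'n functional set" where
  "dual_space P a = (\<Union>\<alpha>. dual_space_upto P a \<alpha>)"


section \<open>Vector spaces over the complex numbers\<close>

definition complex_field :: "complex ring" where
  "complex_field = \<lparr>carrier = UNIV, mult = (*), one = 1, zero = 0, add = (+)\<rparr>"

text \<open>
  \<^const>\<open>vectorspace.dim\<close> is only meaningful in the finite-dimensional case.
\<close>

definition ext_dim :: "('k, 'l) ring_scheme \<Rightarrow> ('k, 'v, 'w) module_scheme \<Rightarrow> enat" where
  "ext_dim K V = (if vectorspace.fin_dim K V then enat (vectorspace.dim K V) else \<infinity>)"

text \<open>The ring components of the record are not used in a vector space.\<close>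

definition functional_space :: "(complex, 'n functional) module" where
  "functional_space =
    \<lparr>carrier = UNIV, mult = undefined, one = undefined, zero = 0, add = (+),
     smult = (\<lambda>b. Poly_Mapping.map ((*) b))\<rparr>"

definition multiplicity_at :: "'n::finite cpoly set \<Rightarrow> complex ^ 'n \<Rightarrow> enat" where
  "multiplicity_at P a = ext_dim complex_field (functional_space\<lparr>carrier := dual_space P a\<rparr>)"


section \<open>Intersection multiplicity\<close>

text \<open>\<open>translate a p\<close> is the polynomial \<open>p(x + a)\<close>.\<close>

definition translate :: "complex ^ 'n::finite \<Rightarrow> 'n cpoly \<Rightarrow> 'n cpoly" where
  "translate a p =
    (\<Sum>m\<in>keys p. single 0 (lookup p m) *
      (\<Prod>i\<in>UNIV. (single (single i 1) 1
                      + single 0 (a $ i)) ^ lookup m i))"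

type_synonym 'n series = "'n mindex \<Rightarrow> complex"

definition convergent_series :: "'n::finite series \<Rightarrow> bool" where
  "convergent_series f \<longleftrightarrow>
    (\<exists>U. open U \<and> 0 \<in> U \<and> (\<forall>x\<in>U. (\<lambda>m. f m * monom_eval m x) summable_on UNIV))"

definition series_mult :: "'n series \<Rightarrow> 'n series \<Rightarrow> 'n series" where
  "series_mult f g m = (\<Sum>(k, l)\<in>{(k, l). k + l = m}. f k * g l)"

definition const_series :: "complex \<Rightarrow> 'n series" where
  "const_series b m = (if m = 0 then b else 0)"

definition series_ring :: "'n::finite series ring" where
  "series_ring =
    \<lparr>carrier = {f. convergent_series f}, mult = series_mult, one = const_series 1,
     zero = const_series 0, add = (\<lambda>f g m. f m + g m)\<rparr>"

definition system_ideal :: "'n::finite cpoly set \<Rightarrow> complex ^ 'n \<Rightarrow> 'n series set" where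
  "system_ideal P a = Idl\<^bsub>series_ring\<^esub> ((\<lambda>p. lookup (translate a p)) ` P)"

definition local_ring :: "'n::finite cpoly set \<Rightarrow> complex ^ 'n \<Rightarrow> 'n series set ring" where
  "local_ring P a = series_ring Quot system_ideal P a"

definition local_algebra ::
  "'n::finite cpoly set \<Rightarrow> complex ^ 'n \<Rightarrow> (complex, 'n series set) module" where
  "local_algebra P a =
    \<lparr>carrier = carrier (local_ring P a), mult = mult (local_ring P a),
     one = one (local_ring P a), zero = zero (local_ring P a), add = add (local_ring P a),
     smult = (\<lambda>b X. (system_ideal P a +>\<^bsub>series_ring\<^esub> const_series b)
                       \<otimes>\<^bsub>local_ring P a\<^esub> X)\<rparr>"

definition intersection_multiplicity :: "'n::finite cpoly set \<Rightarrow> complex ^ 'n \<Rightarrow> enat" where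
  "intersection_multiplicity P a = ext_dim complex_field (local_algebra P a)"


section \<open>Well-definedness\<close>

lemma lookup_partial_deriv:
  "lookup (partial_deriv i p) k = of_nat (Suc (lookup k i)) * lookup p (k + single i 1)"
proof -
  let ?k = "k + single i 1"
  have eq: "lookup (single (m - single i 1) (of_nat (lookup m i) * lookup p m)) k
      = (if m = ?k then of_nat (Suc (lookup k i)) * lookup p ?k else 0)" for m
  proof (cases "lookup m i = 0")
    case True
    then have "m \<noteq> ?k" by (auto simp: lookup_add)
    with True show ?thesis by simp
  next
    case False
    have "m - single i 1 = k \<longleftrightarrow> m = ?k"
      using False by (auto simp: poly_mapping_eq_iff fun_eq_iff lookup_add lookup_minus
          lookup_single when_def)
    then show ?thesis by (auto simp: lookup_single lookup_add)
  qed
  have "lookup (partial_deriv i p) k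
      = (\<Sum>m\<in>keys p. if m = ?k then of_nat (Suc (lookup k i)) * lookup p ?k else 0)"
    by (simp only: partial_deriv_def lookup_sum eq)
  then show ?thesis by (simp add: in_keys_iff)
qed

lemma comp_fun_commute_partial_deriv:
  "comp_fun_commute (\<lambda>i. partial_deriv i ^^ lookup j i)"
proof -
  have "comp_fun_commute (partial_deriv :: 'a \<Rightarrow> _)"
  proof (unfold_locales, rule ext)
    fix x y :: 'a and p
    show "(partial_deriv y \<circ> partial_deriv x) p = (partial_deriv x \<circ> partial_deriv y) p"
      by (intro poly_mapping_eqI)
        (auto simp: lookup_partial_deriv lookup_add lookup_single when_def add.commute add.left_commute)
  qed
  then show ?thesis by (rule comp_fun_commute.comp_fun_commute_funpow)
qed

lemma poly_eval_superset:
  assumes "finite A" "keys p \<subseteq> A"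
  shows "poly_eval p x = (\<Sum>m\<in>A. lookup p m * monom_eval m x)"
  unfolding poly_eval_def using assms by (intro sum.mono_neutral_left) (auto simp: in_keys_iff)

lemma poly_eval_single: "poly_eval (single m c) x = c * monom_eval m x"
  by (subst poly_eval_superset[of "{m}"]) auto

lemma poly_eval_zero: "poly_eval 0 x = 0"
  by (simp add: poly_eval_def)

lemma poly_eval_add: "poly_eval (p + q) x = poly_eval p x + poly_eval q x"
proof -
  let ?A = "keys p \<union> keys q"
  have k: "keys (p + q) \<subseteq> ?A" by (rule Poly_Mapping.keys_add)
  show ?thesis
    by (subst (1 2 3) poly_eval_superset[of ?A])
      (use k in \<open>auto simp: lookup_add algebra_simps sum.distrib\<close>)
qed

lemma poly_eval_sum: "poly_eval (sum f A) x = (\<Sum>a\<in>A. poly_eval (f a) x)"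
  by (induction A rule: infinite_finite_induct) (auto simp: poly_eval_zero poly_eval_add)

lemma poly_sum_singles: "p = (\<Sum>m\<in>keys p. single m (lookup p m))"
  by (intro poly_mapping_eqI) (auto simp: lookup_sum lookup_single when_def in_keys_iff)

lemma monom_eval_add: "monom_eval (k + l) x = monom_eval k x * monom_eval l x"
  by (simp add: monom_eval_def lookup_add power_add prod.distrib)

lemma poly_eval_mult: "poly_eval (p * q) x = poly_eval p x * poly_eval q x"
proof -
  have "p * q = (\<Sum>m\<in>keys p. single m (lookup p m)) * (\<Sum>m\<in>keys q. single m (lookup q m))"
    by (simp flip: poly_sum_singles)
  then have "p * q = (\<Sum>k\<in>keys p. \<Sum>l\<in>keys q. single (k + l) (lookup p k * lookup q l))"
    by (simp add: sum_product mult_single)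
  then have "poly_eval (p * q) x
      = (\<Sum>k\<in>keys p. \<Sum>l\<in>keys q. lookup p k * lookup q l * monom_eval (k + l) x)"
    by (simp only: poly_eval_sum poly_eval_single)
  then show ?thesis
    by (simp add: poly_eval_def sum_product monom_eval_add mult_ac)
qed

lemma poly_eval_one: "poly_eval 1 x = 1"
  by (simp add: poly_eval_single monom_eval_def flip: single_one)

lemma poly_eval_translate: "poly_eval (translate a p) x = poly_eval p (x + a)"
proof -
  have p: "poly_eval (p ^ n) x = poly_eval p x ^ n" for p :: "'a cpoly" and n
    by (induction n) (auto simp: poly_eval_one poly_eval_mult)
  have q: "poly_eval (prod f A) x = (\<Prod>a\<in>A. poly_eval (f a) x)" for f :: "'a \<Rightarrow> 'a cpoly" and A
    by (induction A rule: infinite_finite_induct) (auto simp: poly_eval_one poly_eval_mult)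
  have v: "monom_eval (single i 1) x = x $ i" for i
  proof -
    have "monom_eval (single i 1) x = (\<Prod>k\<in>UNIV. if k = i then x $ k else 1)"
      unfolding monom_eval_def by (intro prod.cong) (auto simp: lookup_single when_def)
    then show ?thesis by simp
  qed
  have c: "monom_eval 0 x = 1" by (simp add: monom_eval_def)
  have "poly_eval (translate a p) x = (\<Sum>m\<in>keys p. lookup p m * (\<Prod>i\<in>UNIV. (x $ i + a $ i) ^ lookup m i))"
    unfolding translate_def poly_eval_sum poly_eval_mult p q poly_eval_add poly_eval_single v c by simp
  then show ?thesis by (simp add: poly_eval_def monom_eval_def)
qed

lemma has_field_derivative_partial_deriv:
  "((\<lambda>z. poly_eval p (\<chi> k. if k = i then z else x $ k))
      has_field_derivative poly_eval (partial_deriv i p) x) (at (x $ i))"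
proof -
  let ?r = "\<lambda>m. \<Prod>k\<in>UNIV - {i}. (x $ k) ^ lookup m k"
  have split: "monom_eval m (\<chi> k. if k = i then z else x $ k) = z ^ lookup m i * ?r m" for m z
    unfolding monom_eval_def by (subst prod.remove[of _ i]) (auto intro!: prod.cong)
  have der: "monom_eval (m - single i 1) x = (x $ i) ^ (lookup m i - 1) * ?r m" for m
    unfolding monom_eval_def
    by (subst prod.remove[of _ i])
      (auto intro!: prod.cong simp: lookup_minus lookup_single when_def)
  have "poly_eval (partial_deriv i p) x
     = (\<Sum>m\<in>keys p. lookup p m * (of_nat (lookup m i) * (x $ i) ^ (lookup m i - 1) * ?r m))"
    unfolding partial_deriv_def poly_eval_sum poly_eval_single der by (simp add: algebra_simps)
  then show ?thesis
    unfolding poly_eval_def[of p] split by (auto intro!: derivative_eq_intros sum.cong)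
qed

lemma field_complex_field: "field complex_field"
proof -
  have "cring complex_field"
  proof (intro cringI abelian_groupI comm_monoidI)
    fix x :: complex
    show "\<exists>y\<in>carrier complex_field. y \<oplus>\<^bsub>complex_field\<^esub> x = \<zero>\<^bsub>complex_field\<^esub>"
      by (intro bexI[of _ "- x"]) (auto simp: complex_field_def)
  qed (auto simp: complex_field_def algebra_simps)
  then show ?thesis
  proof (rule cring.cring_fieldI)
    have "x \<in> Units complex_field" if "x \<noteq> 0" for x
      using that unfolding Units_def by (auto simp: complex_field_def intro!: exI[of _ "inverse x"])
    moreover have "0 \<notin> Units complex_field"
      by (auto simp: Units_def complex_field_def)
    ultimately show "Units complex_field = carrier complex_field - {\<zero>\<^bsub>complex_field\<^esub>}"
      by (auto simp: complex_field_def)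
  qed
qed

lemma vectorspace_functional_space: "vectorspace complex_field functional_space"
proof -
  interpret K: field complex_field by (rule field_complex_field)
  have l: "lookup (Poly_Mapping.map ((*) b) c) j = b * lookup c j" for b :: complex and c :: "'a functional" and j
    by (simp add: map.rep_eq when_def)
  have "module complex_field (functional_space :: (complex, 'a functional) module)"
  proof (intro Module.moduleI abelian_groupI)
    fix x :: "'a functional"
    show "\<exists>y\<in>carrier functional_space. y \<oplus>\<^bsub>functional_space\<^esub> x = \<zero>\<^bsub>functional_space\<^esub>"
      by (intro bexI[of _ "- x"]) (auto simp: functional_space_def)
  qed (auto simp: functional_space_def complex_field_def l lookup_add algebra_simps K.is_cring[unfolded complex_field_def]
       intro!: poly_mapping_eqI)
  then show ?thesis by (simp add: vectorspace_def K.field_axioms)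
qed


lemma lookup_anti_diff: "lookup (anti_diff i c) k = lookup c (k + single i 1)"
proof -
  let ?k = "k + single i 1"
  have eq: "lookup (if lookup m i = 0 then 0 else single (m - single i 1) (lookup c m)) k
      = (if m = ?k then lookup c ?k else 0)" for m
  proof (cases "lookup m i = 0")
    case True
    then have "m \<noteq> ?k" by (auto simp: lookup_add)
    with True show ?thesis by simp
  next
    case False
    have "m - single i 1 = k \<longleftrightarrow> m = ?k"
      using False by (auto simp: poly_mapping_eq_iff fun_eq_iff lookup_add lookup_minus
          lookup_single when_def)
    with False show ?thesis by (auto simp: lookup_single)
  qed
  have "lookup (anti_diff i c) k = (\<Sum>m\<in>keys c. if m = ?k then lookup c ?k else 0)"
    by (simp only: anti_diff_def lookup_sum eq)
  then show ?thesis by (simp add: in_keys_iff)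
qed

lemma lookup_scale:
  "lookup (Poly_Mapping.map ((*) b) c) j = b * lookup c j" for b :: complex
  by (simp add: map.rep_eq when_def)

lemma apply_functional_superset:
  assumes "finite A" "keys c \<subseteq> A"
  shows "apply_functional a c p = (\<Sum>j\<in>A. lookup c j * diff_symbol_at a j p)"
  unfolding apply_functional_def using assms
  by (intro sum.mono_neutral_left) (auto simp: in_keys_iff)

lemma apply_functional_add:
  "apply_functional a (c + d) p = apply_functional a c p + apply_functional a d p"
proof -
  let ?A = "keys c \<union> keys d"
  have k: "keys (c + d) \<subseteq> ?A" by (rule Poly_Mapping.keys_add)
  show ?thesis
    by (subst (1 2 3) apply_functional_superset[of ?A])
      (use k in \<open>auto simp: lookup_add algebra_simps sum.distrib\<close>)
qed

lemma apply_functional_scale: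
  "apply_functional a (Poly_Mapping.map ((*) b) c) p = b * apply_functional a c p"
proof -
  have "keys (Poly_Mapping.map ((*) b) c) \<subseteq> keys c"
    by (auto simp: in_keys_iff lookup_scale)
  then show ?thesis
    by (subst (1 2) apply_functional_superset[of "keys c"])
      (auto simp: lookup_scale sum_distrib_left mult_ac)
qed

lemma single_zero_iff: "c \<in> {single 0 b | b. True} \<longleftrightarrow> (\<forall>j. j \<noteq> 0 \<longrightarrow> lookup c j = 0)"
proof
  assume "\<forall>j. j \<noteq> 0 \<longrightarrow> lookup c j = 0"
  then have "c = single 0 (lookup c 0)"
    by (intro poly_mapping_eqI) (auto simp: lookup_single when_def)
  then show "c \<in> {single 0 b | b. True}" by blast
qed (auto simp: lookup_single when_def)

lemma dual_space_upto_add: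
  "c \<in> dual_space_upto P a \<alpha> \<Longrightarrow> d \<in> dual_space_upto P a \<alpha> \<Longrightarrow> c + d \<in> dual_space_upto P a \<alpha>"
proof (induction \<alpha> arbitrary: c d)
  case 0
  then show ?case unfolding dual_space_upto.simps single_zero_iff by (simp add: lookup_add)
next
  case (Suc \<alpha>)
  have "anti_diff i (c + d) = anti_diff i c + anti_diff i d" for i
    by (intro poly_mapping_eqI) (simp add: lookup_add lookup_anti_diff)
  with Suc Poly_Mapping.keys_add[of c d] show ?case by (auto simp: apply_functional_add)
qed

lemma dual_space_upto_scale:
  "c \<in> dual_space_upto P a \<alpha> \<Longrightarrow> Poly_Mapping.map ((*) b) c \<in> dual_space_upto P a \<alpha>"
proof (induction \<alpha> arbitrary: c)
  case 0
  then show ?case unfolding dual_space_upto.simps single_zero_iff by (simp add: lookup_scale)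
next
  case (Suc \<alpha>)
  have "anti_diff i (Poly_Mapping.map ((*) b) c) = Poly_Mapping.map ((*) b) (anti_diff i c)" for i
    by (intro poly_mapping_eqI) (simp add: lookup_scale lookup_anti_diff)
  with Suc show ?case by (auto simp: apply_functional_scale in_keys_iff lookup_scale)
qed

lemma dual_space_upto_Suc:
  assumes "a \<in> zero_set P"
  shows "dual_space_upto P a \<alpha> \<subseteq> dual_space_upto P a (Suc \<alpha>)"
proof (induction \<alpha>)
  case 0
  have i: "iter_deriv 0 p = p" for p :: "'a cpoly"
  proof -
    have *: "(\<lambda>i. partial_deriv i ^^ lookup 0 i) = (\<lambda>i::'a. \<lambda>q. q)"
      by (simp add: fun_eq_iff)
    interpret comp_fun_commute "\<lambda>i::'a. \<lambda>q::'a cpoly. q" by unfold_locales auto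
    have "Finite_Set.fold (\<lambda>i::'a. \<lambda>q. q) p A = p" if "finite A" for A
      using that by (induction A rule: finite_induct) auto
    then show ?thesis unfolding iter_deriv_def * by simp
  qed
  have "apply_functional a (single 0 b) p = 0" if "p \<in> P" for b p
    using that assms
    by (subst apply_functional_superset[of "{0}"]) (auto simp: diff_symbol_at_def i zero_set_def)
  moreover have "anti_diff i (single 0 b) \<in> dual_space_upto P a 0" for i b
    unfolding dual_space_upto.simps single_zero_iff lookup_anti_diff
    by (auto simp: lookup_single when_def poly_mapping_eq_iff fun_eq_iff lookup_add split: if_splits)
  moreover have "mindex_size j \<le> Suc 0" if "j \<in> keys (single 0 b)" for j :: "'a mindex" and b :: complex
    using that by (auto simp: in_keys_iff lookup_single when_def mindex_size_def split: if_splits)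
  ultimately show ?case by auto
next
  case (Suc \<alpha>)
  then show ?case by (fastforce simp: le_Suc_eq)
qed

lemma subspace_dual_space:
  assumes "a \<in> zero_set P"
  shows "VectorSpace.subspace complex_field (dual_space P a) functional_space"
proof -
  interpret vectorspace complex_field "functional_space :: (complex, 'a functional) module"
    by (rule vectorspace_functional_space)
  have mono: "dual_space_upto P a \<alpha> \<subseteq> dual_space_upto P a \<beta>" if "\<alpha> \<le> \<beta>" for \<alpha> \<beta>
    using that dual_space_upto_Suc[OF assms] by (rule lift_Suc_mono_le[rotated])
  have add: "c + d \<in> dual_space P a" if "c \<in> dual_space P a" "d \<in> dual_space P a" for c d
  proof -
    from that obtain \<alpha> \<beta> where "c \<in> dual_space_upto P a \<alpha>" "d \<in> dual_space_upto P a \<beta>"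
      by (auto simp: dual_space_def)
    then have "c \<in> dual_space_upto P a (max \<alpha> \<beta>)" "d \<in> dual_space_upto P a (max \<alpha> \<beta>)"
      using mono[of \<alpha> "max \<alpha> \<beta>"] mono[of \<beta> "max \<alpha> \<beta>"] by auto
    then show ?thesis by (auto simp: dual_space_def intro: dual_space_upto_add)
  qed
  have "0 \<in> dual_space_upto P a 0"
    unfolding dual_space_upto.simps single_zero_iff by simp
  then have z: "0 \<in> dual_space P a" unfolding dual_space_def by blast
  have "LinearCombinations.submodule complex_field (dual_space P a) functional_space"
    by (intro LinearCombinations.submodule.intro module_axioms)
      (use z add in \<open>auto simp: functional_space_def complex_field_def dual_space_def
        intro: dual_space_upto_scale\<close>)
  then show ?thesis
    by (simp add: VectorSpace.subspace_def vectorspace_functional_space)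
qed

lemma vectorspace_dual_space:
  assumes "a \<in> zero_set P"
  shows "vectorspace complex_field (functional_space\<lparr>carrier := dual_space P a\<rparr>)"
  by (rule vectorspace.subspace_is_vs[OF vectorspace_functional_space subspace_dual_space[OF assms]])

lemma finite_mindex_splits: "finite {(k, l). k + l = (m :: 'n::finite mindex)}"
proof -
  let ?B = "{f. \<forall>i. f i \<le> lookup m i}"
  have "?B = PiE UNIV (\<lambda>i. {..lookup m i})" by auto
  moreover have "finite (PiE UNIV (\<lambda>i. {..lookup m i}))" by (intro finite_PiE) auto
  ultimately have "finite ?B" by simp
  moreover have "lookup ` {k. \<exists>l. k + l = m} \<subseteq> ?B" by (auto simp: lookup_add)
  ultimately have "finite (lookup ` {k. \<exists>l. k + l = m})" by (rule finite_subset[rotated])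
  then have "finite {k. \<exists>l. k + l = m}"
    by (rule finite_imageD) (auto intro!: inj_onI poly_mapping_eqI)
  moreover have "{(k, l). k + l = m} \<subseteq> (\<lambda>k. (k, m - k)) ` {k. \<exists>l. k + l = m}" by auto
  ultimately show ?thesis by (meson finite_imageI finite_subset)
qed

lemma series_mult_commute: "series_mult f g = series_mult g f"
proof (rule ext)
  fix m
  show "series_mult f g m = series_mult g f m"
    unfolding series_mult_def
    by (rule sum.reindex_bij_witness[of _ prod.swap prod.swap]) (auto simp: add.commute mult.commute)
qed

lemma series_mult_assoc:
  fixes f :: "'n::finite series"
  shows "series_mult (series_mult f g) h = series_mult f (series_mult g h)"
proof (rule ext)
  fix m
  let ?S = "\<lambda>m. {(k, l). k + l = (m :: 'n mindex)}"
  have "series_mult (series_mult f g) h m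
      = (\<Sum>z\<in>?S m. \<Sum>y\<in>?S (fst z). f (fst y) * g (snd y) * h (snd z))"
    by (simp add: series_mult_def sum_distrib_right case_prod_beta)
  also have "\<dots> = (\<Sum>(z, y)\<in>Sigma (?S m) (\<lambda>z. ?S (fst z)). f (fst y) * g (snd y) * h (snd z))"
    by (rule sum.Sigma) (auto intro: finite_mindex_splits)
  also have "\<dots> = (\<Sum>(z, y)\<in>Sigma (?S m) (\<lambda>z. ?S (snd z)). f (fst z) * (g (fst y) * h (snd y)))"
    by (rule sum.reindex_bij_witness[of _
          "\<lambda>((k, n), (l, r)). ((k + l, r), (k, l))" "\<lambda>((n, r), (k, l)). ((k, l + r), (l, r))"])
      (auto simp: add.assoc mult.assoc)
  also have "\<dots> = (\<Sum>z\<in>?S m. \<Sum>y\<in>?S (snd z). f (fst z) * (g (fst y) * h (snd y)))"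
    by (rule sum.Sigma[symmetric]) (auto intro: finite_mindex_splits)
  also have "\<dots> = series_mult f (series_mult g h) m"
    by (simp add: series_mult_def sum_distrib_left case_prod_beta)
  finally show "series_mult (series_mult f g) h m = series_mult f (series_mult g h) m" .
qed

lemma series_mult_const: 
  fixes f :: "'n::finite series"
  shows "series_mult (const_series b) f = (\<lambda>m. b * f m)"
proof (rule ext)
  fix m
  have "series_mult (const_series b) f m = (\<Sum>z\<in>{(0 :: 'n mindex, m)}. const_series b (fst z) * f (snd z))"
    unfolding series_mult_def
    by (rule sum.mono_neutral_cong_right)
      (auto simp: const_series_def finite_mindex_splits split: if_splits)
  then show "series_mult (const_series b) f m = b * f m" by (simp add: const_series_def)
qed

lemma convergent_series_lookup: "convergent_series (lookup p)"
proof -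
  have "(\<lambda>m. lookup p m * monom_eval m x) summable_on UNIV" for x
    by (rule finite_nonzero_values_imp_summable_on, rule finite_subset[OF _ finite_keys[of p]])
      (auto simp: in_keys_iff)
  then show ?thesis unfolding convergent_series_def by (intro exI[of _ UNIV]) auto
qed

lemma convergent_series_const: "convergent_series (const_series b :: 'n::finite series)"
proof -
  have "const_series b = lookup (single (0 :: 'n mindex) b)"
    by (auto simp: const_series_def lookup_single when_def fun_eq_iff)
  then show ?thesis by (simp only: convergent_series_lookup)
qed

lemma convergent_series_add:
  assumes "convergent_series f" "convergent_series g"
  shows "convergent_series (\<lambda>m. f m + g m)"
proof -
  from assms obtain U V where "open U" "0 \<in> U" "open V" "0 \<in> V"
    and "\<forall>x\<in>U. (\<lambda>m. f m * monom_eval m x) summable_on UNIV"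
    and "\<forall>x\<in>V. (\<lambda>m. g m * monom_eval m x) summable_on UNIV"
    unfolding convergent_series_def by blast
  then show ?thesis
    unfolding convergent_series_def
    by (intro exI[of _ "U \<inter> V"]) (auto simp: distrib_right intro: summable_on_add)
qed

lemma convergent_series_mult:
  fixes f :: "'n::finite series"
  assumes "convergent_series f" "convergent_series g"
  shows "convergent_series (series_mult f g)"
proof -
  from assms obtain U V where *: "open U" "0 \<in> U" "open V" "0 \<in> V"
    "\<forall>x\<in>U. (\<lambda>m. f m * monom_eval m x) summable_on UNIV"
    "\<forall>x\<in>V. (\<lambda>m. g m * monom_eval m x) summable_on UNIV"
    unfolding convergent_series_def by blast
  have "(\<lambda>m. series_mult f g m * monom_eval m x) summable_on UNIV" if "x \<in> U" "x \<in> V" for x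
  proof -
    let ?f = "\<lambda>m. f m * monom_eval m x" and ?g = "\<lambda>m. g m * monom_eval m x"
    let ?S = "\<lambda>m. {(k, l). k + l = (m :: 'n mindex)}"
    have f: "(\<lambda>m. norm (?f m)) summable_on UNIV" and g: "(\<lambda>m. norm (?g m)) summable_on UNIV"
      using * that by (auto simp: summable_on_iff_abs_summable_on_complex[symmetric])
    have "(\<lambda>z. norm ((\<lambda>(k, l). ?f k * ?g l) z)) summable_on (UNIV \<times> UNIV)"
      unfolding Infinite_Sum.abs_summable_on_Sigma_iff
      using f g by (auto simp: norm_mult infsum_cmult_right' abs_mult infsum_nonneg intro!: summable_on_cmult_right
          summable_on_cmult_left simp del: UNIV_Times_UNIV)
    then have "(\<lambda>(k, l). ?f k * ?g l) summable_on UNIV"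
      by (simp add: Infinite_Sum.abs_summable_summable)
    also have "?this \<longleftrightarrow> (\<lambda>(m, k, l). ?f k * ?g l) summable_on Sigma UNIV ?S"
      by (rule summable_on_reindex_bij_witness[of _ "\<lambda>(m, k, l). (k, l)" "\<lambda>(k, l). (k + l, k, l)"]) auto
    finally have "(\<lambda>m. infsum (\<lambda>(k, l). ?f k * ?g l) (?S m)) summable_on UNIV"
      by (rule Infinite_Sum.summable_on_Sigma_banach)
    moreover have "infsum (\<lambda>(k, l). ?f k * ?g l) (?S m) = series_mult f g m * monom_eval m x" for m
      unfolding series_mult_def sum_distrib_right
      by (subst infsum_finite[OF finite_mindex_splits])
        (auto intro!: sum.cong simp: monom_eval_add)
    ultimately show ?thesis by simp
  qed
  with * show ?thesis
    unfolding convergent_series_def by (intro exI[of _ "U \<inter> V"]) auto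
qed

lemma cring_series_ring: "cring series_ring"
proof (intro cringI abelian_groupI comm_monoidI)
  fix f :: "'a series"
  assume "f \<in> carrier series_ring"
  then have "convergent_series (series_mult (const_series (- 1)) f)"
    by (auto simp: series_ring_def intro!: convergent_series_mult convergent_series_const)
  then show "\<exists>g\<in>carrier series_ring. g \<oplus>\<^bsub>series_ring\<^esub> f = \<zero>\<^bsub>series_ring\<^esub>"
    by (intro bexI[of _ "\<lambda>m. - f m"]) (auto simp: series_ring_def const_series_def series_mult_const)
next
  fix f g :: "'a series"
  show "f \<otimes>\<^bsub>series_ring\<^esub> g = g \<otimes>\<^bsub>series_ring\<^esub> f"
    by (simp add: series_ring_def series_mult_commute)
next
  fix f g h :: "'a series"
  show "(f \<oplus>\<^bsub>series_ring\<^esub> g) \<otimes>\<^bsub>series_ring\<^esub> h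
      = f \<otimes>\<^bsub>series_ring\<^esub> h \<oplus>\<^bsub>series_ring\<^esub> g \<otimes>\<^bsub>series_ring\<^esub> h"
    by (simp add: series_ring_def series_mult_def fun_eq_iff distrib_right sum.distrib case_prod_beta)
qed (auto simp: series_ring_def convergent_series_add convergent_series_mult convergent_series_const
      series_mult_assoc series_mult_const add_ac const_series_def[of 0])

lemma ideal_system_ideal: "ideal (system_ideal P a) series_ring"
  unfolding system_ideal_def
  by (rule ring.genideal_ideal[OF cring.axioms(1)[OF cring_series_ring]])
    (auto simp: series_ring_def convergent_series_lookup)

lemma vectorspace_local_algebra: "vectorspace complex_field (local_algebra P a)"
proof -
  let ?I = "system_ideal P a"
  let ?c = "\<lambda>b. ?I +>\<^bsub>series_ring\<^esub> const_series b"
  interpret K: field complex_field by (rule field_complex_field)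
  interpret ideal ?I series_ring by (rule ideal_system_ideal)
  interpret Q: cring "local_ring P a"
    unfolding local_ring_def by (rule quotient_is_cring[OF cring_series_ring])
  interpret h: ring_hom_cring series_ring "local_ring P a" "(+>\<^bsub>series_ring\<^esub>) ?I"
    unfolding local_ring_def by (rule rcos_ring_hom_cring[OF cring_series_ring])
  have c: "const_series b \<in> carrier series_ring" for b :: complex
    by (simp add: series_ring_def convergent_series_const)
  have add: "const_series (b + d) = const_series b \<oplus>\<^bsub>series_ring\<^esub> const_series d" for b d
    by (auto simp: series_ring_def const_series_def)
  have mult: "const_series (b * d) = const_series b \<otimes>\<^bsub>series_ring\<^esub> const_series d" for b d
    by (auto simp: series_ring_def series_mult_const) (auto simp: const_series_def)
  have one: "const_series 1 = \<one>\<^bsub>series_ring\<^esub>" by (simp add: series_ring_def)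
  have "abelian_group (local_algebra P a)"
    by (intro abelian_groupI)
      (auto simp: local_algebra_def Q.add.m_assoc Q.add.m_lcomm Q.add.m_comm intro: Q.a_inv_closed Q.l_neg)
  then have "module complex_field (local_algebra P a)"
    by (intro Module.moduleI K.is_cring)
      (auto simp: local_algebra_def complex_field_def add mult one c Q.l_distr Q.r_distr Q.m_assoc)
  then show ?thesis by (simp add: vectorspace_def field_complex_field)
qed

end

theory Submission
  imports Defs "HOL-Algebra.Ideal_Product"
begin

text \<open>
  Move \<open>a\<close> to the origin, and let \<open>I\<close> be the ideal of \<open>P\<close> in the ring \<open>R\<close> of convergent power
  series, with \<open>m\<close> the maximal ideal of \<open>R\<close>. A differential functional \<open>c\<close> acts on a series through
  finitely many of its Taylor coefficients, \<open>\<langle>c, f\<rangle> = \<Sum>\<^sub>j c\<^sub>j f\<^sub>j\<close>, and this makes sense on all of \<open>R\<close>.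
  Anti-differentiation is adjoint to multiplication by a variable, \<open>\<langle>\<phi>\<^sub>i c, f\<rangle> = \<langle>c, x\<^sub>i f\<rangle>\<close>.
  The recursion that defines the dual space \<open>D\<close> therefore says that \<open>c\<close> kills every
  product of a monomial and an element of \<open>P\<close>, that is, that \<open>c\<close> kills \<open>I\<close>; the start of
  the recursion agrees with this because \<open>a\<close> is a zero of \<open>P\<close>
  (\<open>dual_space_eq_annihilator\<close>). So \<open>D\<close> is paired with the local algebra \<open>R / I\<close>, and the
  theorem is the statement that both sides of this pairing have the same dimension.

  If a bilinear pairing of \<open>V\<close> and \<open>W\<close> has no left kernel, then \<open>dim V \<le> dim W\<close>
  (\<open>ext_dim_le\<close>). A functional \<open>c\<close> that kills every monomial is zero, so
  \<open>dim D \<le> dim R / I\<close>. For the other inequality only finite \<open>dim D\<close> matters. In that case the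
  supports of the elements of \<open>D\<close> are bounded, say by degrees smaller than \<open>k\<close>. This forces
  \<open>m\<^sup>k \<subseteq> I\<close>: each monomial \<open>x\<^sup>l\<close> of degree \<open>k\<close> lies in \<open>I + m\<^sup>k\<^sup>+\<^sup>1\<close>, since otherwise a linear
  functional on the Taylor polynomials of degree at most \<open>k\<close> would vanish on \<open>I\<close> but not at \<open>x\<^sup>l\<close>,
  and would be an element of \<open>D\<close> whose support contains \<open>l\<close>; and from \<open>m\<^sup>k \<subseteq> I + m \<cdot> m\<^sup>k\<close>
  Nakayama's lemma gives \<open>m\<^sup>k \<subseteq> I\<close> (\<open>mem_ideal_of_high_order\<close>). Membership in \<open>I\<close> is
  then decided by finitely many Taylor coefficients, so the same separation argument produces, for every
  \<open>f\<close> outside \<open>I\<close>, an element of \<open>D\<close> that does not kill \<open>f\<close>. The pairing has no right kernel, and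
  \<open>dim R / I \<le> dim D\<close>.

  Two facts about convergence enter: \<open>1 - f\<close> is invertible in \<open>R\<close> for \<open>f \<in> m\<close>, which
  Nakayama's lemma requires, and a convergent series of order at least \<open>k\<close> is a combination of the
  monomials of degree \<open>k\<close> with convergent coefficients. Both follow from majorants.
\<close>

section \<open>Dimensions and bilinear pairings\<close>

text \<open>
  A vector outside a subspace of a finite-dimensional coordinate space is separated from it by a
  linear form. Vectors here are functions of which only the values on \<open>B\<close> count. This saves restricting
  power series to finitely many coefficients: ideals can be used as subspaces as they stand.
\<close>

lemma separating_coefficients:
  fixes U :: "('b \<Rightarrow> complex) set" and v :: "'b \<Rightarrow> complex"
  assumes "finite B"
    and "(\<lambda>_. 0) \<in> U"
    and "\<And>f g. f \<in> U \<Longrightarrow> g \<in> U \<Longrightarrow> (\<lambda>x. f x + g x) \<in> U"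
    and "\<And>b f. f \<in> U \<Longrightarrow> (\<lambda>x. b * f x) \<in> U"
    and "\<nexists>u. u \<in> U \<and> (\<forall>x\<in>B. u x = v x)"
  obtains c where "\<And>u. u \<in> U \<Longrightarrow> (\<Sum>x\<in>B. c x * u x) = 0" "(\<Sum>x\<in>B. c x * v x) = 1"
  using assms
proof (induction "card B" arbitrary: B U v thesis)
  case 0
  then show ?case by auto
next
  case (Suc n)
  note U0 = Suc.prems(3) and Uadd = Suc.prems(4) and Uscale = Suc.prems(5)
  show ?case
  proof (cases "\<exists>u\<in>U. \<exists>x\<in>B. u x \<noteq> 0")
    case False
    obtain b where b: "b \<in> B" "v b \<noteq> 0"
      using Suc.prems(6) U0 by (metis (full_types))
    show ?thesis
    proof (rule Suc.prems(1))
      let ?c = "\<lambda>x. if x = b then inverse (v b) else 0"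
      have *: "(\<Sum>x\<in>B. ?c x * u x) = inverse (v b) * u b" for u
        using b(1) \<open>finite B\<close> by (simp add: if_distrib[of "\<lambda>z. z * _"] cong: if_cong)
      show "(\<Sum>x\<in>B. ?c x * u x) = 0" if "u \<in> U" for u
        unfolding * using False b that by simp
      show "(\<Sum>x\<in>B. ?c x * v x) = 1"
        unfolding * using b by simp
    qed
  next
    case True
    then obtain u1 b where u1: "u1 \<in> U" "b \<in> B" "u1 b \<noteq> 0" by blast
    define u0 where "u0 = (\<lambda>x. inverse (u1 b) * u1 x)"
    have u0: "u0 \<in> U" "u0 b = 1"
      using u1 Uscale[of u1 "inverse (u1 b)"] by (auto simp: u0_def)
    let ?B = "B - {b}" and ?U = "{u \<in> U. u b = 0}"
    \<comment> \<open>Subtracting a multiple of \<open>u0\<close> projects onto the functions that vanish at \<open>b\<close>.\<close>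
    let ?proj = "\<lambda>u x. u x + (- u b) * u0 x"
    have "card ?B = n" "finite ?B"
      using Suc.hyps(2) Suc.prems(2) u1(2) by auto
    have "\<nexists>u. u \<in> ?U \<and> (\<forall>x\<in>?B. u x = ?proj v x)"
    proof
      assume "\<exists>u. u \<in> ?U \<and> (\<forall>x\<in>?B. u x = ?proj v x)"
      then obtain u where u: "u \<in> U" "u b = 0" "\<And>x. x \<in> ?B \<Longrightarrow> u x = ?proj v x" by blast
      have "(\<lambda>x. u x + v b * u0 x) \<in> U"
        using u(1) u0(1) by (intro Uadd Uscale)
      moreover have "u x + v b * u0 x = v x" if "x \<in> B" for x
        using u(2,3) u0(2) that by (cases "x = b") auto
      ultimately show False using Suc.prems(6) by blast
    qed
    then obtain c where c: "\<And>u. u \<in> ?U \<Longrightarrow> (\<Sum>x\<in>?B. c x * u x) = 0"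
      "(\<Sum>x\<in>?B. c x * ?proj v x) = 1"
      using Suc.hyps(1)[of ?B ?U "?proj v"] \<open>card ?B = n\<close> \<open>finite ?B\<close> U0 Uadd Uscale by auto
    \<comment> \<open>The coefficient at \<open>b\<close> makes the extended form vanish on \<open>u0\<close>.\<close>
    let ?c = "\<lambda>x. if x = b then - (\<Sum>x\<in>?B. c x * u0 x) else c x"
    have *: "(\<Sum>x\<in>B. ?c x * u x) = (\<Sum>x\<in>?B. c x * ?proj u x)" for u
    proof -
      have "(\<Sum>x\<in>B. ?c x * u x) = ?c b * u b + (\<Sum>x\<in>?B. ?c x * u x)"
        by (rule sum.remove) (use u1 Suc.prems(2) in auto)
      also have "(\<Sum>x\<in>?B. ?c x * u x) = (\<Sum>x\<in>?B. c x * u x)"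
        by (rule sum.cong) auto
      finally show ?thesis
        by (simp add: algebra_simps sum_distrib_left sum_subtractf flip: sum.distrib)
    qed
    have "?proj u \<in> ?U" if "u \<in> U" for u
      using that Uadd[OF that Uscale[OF u0(1), of "- u b"]] u0 by auto
    then show ?thesis
      using c by (intro Suc.prems(1)[of ?c]) (simp_all only: *)
  qed
qed

lemma complex_field_simps [simp]:
  "carrier complex_field = UNIV" "\<zero>\<^bsub>complex_field\<^esub> = 0" "\<one>\<^bsub>complex_field\<^esub> = 1"
  "x \<oplus>\<^bsub>complex_field\<^esub> y = x + y" "x \<otimes>\<^bsub>complex_field\<^esub> y = x * y"
  by (simp_all add: complex_field_def)

text \<open>
  Linearly independent families describe finite and infinite dimensions alike, so that dimensions
  can be compared without a case distinction on finiteness.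
\<close>

lemma enat_le_ext_dim_iff:
  assumes "vectorspace K V"
  shows "enat n \<le> ext_dim K V \<longleftrightarrow>
    (\<exists>A\<subseteq>carrier V. finite A \<and> card A = n \<and> \<not> module.lin_dep K V A)"
proof -
  interpret vectorspace K V by fact
  have sub: "\<not> lin_dep B" if "\<not> lin_dep A" "B \<subseteq> A" for A B
    using that unfolding lin_dep_def by blast
  show ?thesis
  proof
    assume "\<exists>A\<subseteq>carrier V. finite A \<and> card A = n \<and> \<not> lin_dep A"
    then show "enat n \<le> ext_dim K V"
      using li_le_dim(2) by (auto simp: ext_dim_def)
  next
    assume n: "enat n \<le> ext_dim K V"
    show "\<exists>A\<subseteq>carrier V. finite A \<and> card A = n \<and> \<not> lin_dep A"
    proof (cases fin_dim)
      case True
      then obtain B where B: "finite B" "basis B" using finite_basis_exists by blast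
      then have "n \<le> card B" using n True dim_basis by (simp add: ext_dim_def)
      then obtain A where "A \<subseteq> B" "card A = n" "finite A"
        using obtain_subset_with_card_n by metis
      with B show ?thesis unfolding basis_def by (metis sub subset_trans)
    next
      case False
      show ?thesis
      proof (induction n)
        case 0
        show ?case by (intro exI[of _ "{}"]) (auto simp: lin_dep_def)
      next
        case (Suc n)
        then obtain A where A: "A \<subseteq> carrier V" "finite A" "card A = n" "\<not> lin_dep A" by blast
        moreover obtain v where v: "v \<in> carrier V" "v \<notin> span A"
          using False A span_is_subset2[OF A(1)] unfolding fin_dim_def by blast
        moreover have "v \<notin> A" using span_mem[OF A(1)] v by blast
        ultimately have "\<not> lin_dep (A \<union> {v})" using lin_dep_iff_in_span by blast
        then show ?case using A v \<open>v \<notin> A\<close> by (intro exI[of _ "A \<union> {v}"]) auto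
      qed
    qed
  qed
qed

locale complex_pairing =
  V: vectorspace complex_field V + W: vectorspace complex_field W
  for V :: "(complex, 'v, 'x) module_scheme" and W :: "(complex, 'w, 'y) module_scheme" +
  fixes pair :: "'v \<Rightarrow> 'w \<Rightarrow> complex"
  assumes pair_add_left:
      "\<lbrakk>x \<in> carrier V; y \<in> carrier V; w \<in> carrier W\<rbrakk> \<Longrightarrow> pair (x \<oplus>\<^bsub>V\<^esub> y) w = pair x w + pair y w"
    and pair_smult_left:
      "\<lbrakk>x \<in> carrier V; w \<in> carrier W\<rbrakk> \<Longrightarrow> pair (b \<odot>\<^bsub>V\<^esub> x) w = b * pair x w"
    and pair_add_right:
      "\<lbrakk>x \<in> carrier V; w \<in> carrier W; z \<in> carrier W\<rbrakk> \<Longrightarrow> pair x (w \<oplus>\<^bsub>W\<^esub> z) = pair x w + pair x z"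
    and pair_smult_right:
      "\<lbrakk>x \<in> carrier V; w \<in> carrier W\<rbrakk> \<Longrightarrow> pair x (b \<odot>\<^bsub>W\<^esub> w) = b * pair x w"
begin

lemma flipped: "complex_pairing W V (\<lambda>w v. pair v w)"
  by unfold_locales (auto simp: pair_add_left pair_smult_left pair_add_right pair_smult_right)

lemma pair_zero_left: "w \<in> carrier W \<Longrightarrow> pair \<zero>\<^bsub>V\<^esub> w = 0"
  using pair_add_left[of "\<zero>\<^bsub>V\<^esub>" "\<zero>\<^bsub>V\<^esub>" w] by simp

lemma pair_lincomb_left:
  assumes "finite A" "A \<subseteq> carrier V" "w \<in> carrier W"
  shows "pair (V.lincomb c A) w = (\<Sum>v\<in>A. c v * pair v w)"
  using assms
proof (induction A rule: finite_induct)
  case empty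
  then show ?case by (simp add: V.lincomb_def pair_zero_left)
next
  case (insert v A)
  then have "V.lincomb c (insert v A) = c v \<odot>\<^bsub>V\<^esub> v \<oplus>\<^bsub>V\<^esub> V.lincomb c A"
    by (intro V.lincomb_insert2) auto
  with insert show ?case by (simp add: pair_add_left pair_smult_left V.lincomb_closed)
qed

end

sublocale complex_pairing \<subseteq> flip: complex_pairing W V "\<lambda>w v. pair v w"
  by (rule flipped)

text \<open>
  Every finite linearly independent set \<open>A\<close> in \<open>V\<close> has a dual family in \<open>W\<close>, and a dual
  family is linearly independent. For the vectors \<open>(pair v w)\<close>, with \<open>v\<close> running through \<open>A\<close>, fill the
  whole coordinate space as \<open>w\<close> varies: a linear form vanishing on all of them is a combination of \<open>A\<close>
  in the left kernel.
\<close>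

lemma (in complex_pairing) ext_dim_le:
  assumes nondeg: "\<And>v. v \<in> carrier V \<Longrightarrow> (\<And>w. w \<in> carrier W \<Longrightarrow> pair v w = 0) \<Longrightarrow> v = \<zero>\<^bsub>V\<^esub>"
  shows "ext_dim complex_field V \<le> ext_dim complex_field W"
proof -
  have "enat n \<le> ext_dim complex_field W" if "enat n \<le> ext_dim complex_field V" for n
  proof -
    obtain A where A: "A \<subseteq> carrier V" "finite A" "card A = n" "\<not> V.lin_dep A"
      using \<open>enat n \<le> ext_dim complex_field V\<close> enat_le_ext_dim_iff[OF V.vectorspace_axioms] by metis
    have AV: "v \<in> carrier V" if "v \<in> A" for v using A(1) that by blast
    \<comment> \<open>The coordinate vectors of the elements of \<open>W\<close>.\<close>
    let ?U = "(\<lambda>w v. if v \<in> A then pair v w else 0) ` carrier W"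
    have dual: "\<exists>w\<in>carrier W. \<forall>v\<in>A. pair v w = (if v = u then 1 else 0)" if "u \<in> A" for u
    proof (rule ccontr)
      assume no: "\<not> ?thesis"
      have "\<exists>c. (\<forall>f\<in>?U. (\<Sum>v\<in>A. c v * f v) = 0) \<and> (\<Sum>v\<in>A. c v * (if v = u then 1 else 0)) = 1"
      proof (rule separating_coefficients[OF \<open>finite A\<close>, of ?U "\<lambda>v. if v = u then 1 else 0"])
        show "(\<lambda>_. 0) \<in> ?U"
          using AV by (intro image_eqI[of _ _ "\<zero>\<^bsub>W\<^esub>"]) (auto simp: flip.pair_zero_left fun_eq_iff)
        show "(\<lambda>x. f x + g x) \<in> ?U" if fg: "f \<in> ?U" "g \<in> ?U" for f g
        proof -
          from fg obtain w z where "w \<in> carrier W" "z \<in> carrier W"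
            "f = (\<lambda>v. if v \<in> A then pair v w else 0)" "g = (\<lambda>v. if v \<in> A then pair v z else 0)" by blast
          then show ?thesis
            using AV by (intro image_eqI[of _ _ "w \<oplus>\<^bsub>W\<^esub> z"]) (auto simp: pair_add_right)
        qed
        show "(\<lambda>x. b * f x) \<in> ?U" if fU: "f \<in> ?U" for b f
        proof -
          from fU obtain w where "w \<in> carrier W" "f = (\<lambda>v. if v \<in> A then pair v w else 0)" by blast
          then show ?thesis
            using AV by (intro image_eqI[of _ _ "b \<odot>\<^bsub>W\<^esub> w"]) (auto simp: pair_smult_right)
        qed
        show "\<nexists>f. f \<in> ?U \<and> (\<forall>x\<in>A. f x = (if x = u then 1 else 0))"
          using no by auto
      qed blast
      then obtain c where c: "\<forall>f\<in>?U. (\<Sum>v\<in>A. c v * f v) = 0"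
        "(\<Sum>v\<in>A. c v * (if v = u then 1 else 0)) = 1" by blast
      have "V.lincomb c A = \<zero>\<^bsub>V\<^esub>"
      proof (rule nondeg)
        show "V.lincomb c A \<in> carrier V" using A by (auto intro: V.lincomb_closed)
        show "pair (V.lincomb c A) w = 0" if "w \<in> carrier W" for w
          using c(1) that A by (simp add: pair_lincomb_left)
      qed
      moreover have "c u = 1"
        using c(2) that A(2) by (simp add: if_distrib[of "\<lambda>z. _ * z"] cong: if_cong)
      ultimately have "V.lin_dep A"
        unfolding V.lin_dep_def using that A by (intro exI[of _ A] exI[of _ c] exI[of _ u]) auto
      with A(4) show False ..
    qed
    then obtain d where d: "\<And>u. u \<in> A \<Longrightarrow> d u \<in> carrier W"
      "\<And>u v. u \<in> A \<Longrightarrow> v \<in> A \<Longrightarrow> pair v (d u) = (if v = u then 1 else 0)" by metis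
    have inj: "inj_on d A"
      by (rule inj_onI) (metis d(2) zero_neq_one)
    have "\<not> W.lin_dep (d ` A)"
    proof
      assume "W.lin_dep (d ` A)"
      then obtain B c x where B: "finite B" "B \<subseteq> d ` A" "W.lincomb c B = \<zero>\<^bsub>W\<^esub>" "x \<in> B" "c x \<noteq> 0"
        unfolding W.lin_dep_def by auto
      then obtain u where u: "u \<in> A" "x = d u" by blast
      have "pair u y = (if y = x then 1 else 0)" if "y \<in> B" for y
        using that B(2) u d(2) inj by (auto simp: inj_on_eq_iff)
      then have "(\<Sum>y\<in>B. c y * pair u y) = (\<Sum>y\<in>B. if y = x then c x else 0)"
        by (intro sum.cong) auto
      moreover have "(\<Sum>y\<in>B. c y * pair u y) = pair u (W.lincomb c B)"
        using B u A d(1) by (intro flip.pair_lincomb_left[symmetric]) auto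
      ultimately show False
        using B u A flip.pair_zero_left[of u] by auto
    qed
    then show ?thesis
      unfolding enat_le_ext_dim_iff[OF W.vectorspace_axioms] using A d(1) inj
      by (intro exI[of _ "d ` A"]) (auto simp: card_image)
  qed
  note le = this
  show ?thesis
  proof (rule ccontr)
    assume "\<not> ?thesis"
    then obtain n where "ext_dim complex_field W = enat n" "enat (Suc n) \<le> ext_dim complex_field V"
      by (cases "ext_dim complex_field W") (auto simp: not_le Suc_ile_eq)
    then show False using le[of "Suc n"] by simp
  qed
qed

text \<open>
  Pairing with the coset of a monomial reads off one coefficient of a functional. In that case the lemma
  says that the supports of finitely many generators cover the support of every functional.
\<close>

lemma (in complex_pairing) pair_eq_0_of_generators:
  assumes "finite A" "A \<subseteq> carrier V" "V.gen_set A" "w \<in> carrier W" "\<And>v. v \<in> A \<Longrightarrow> pair v w = 0"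
    and "v \<in> carrier V"
  shows "pair v w = 0"
proof -
  obtain c where "v = V.lincomb c A"
    using assms(3,6) V.finite_span[OF assms(1,2)] by blast
  then show ?thesis using assms by (simp add: pair_lincomb_left)
qed

section \<open>Nakayama's lemma\<close>

lemma (in cring) add_mult_mem_ideal:
  assumes "ideal I R" "J \<subseteq> carrier R"
    and "\<And>a. a \<in> J \<Longrightarrow> \<one> \<ominus> a \<in> Units R"
    and "i \<in> I" "a \<in> J" "s \<in> carrier R" "s = i \<oplus> a \<otimes> s"
  shows "s \<in> I"
proof -
  interpret I: ideal I R by fact
  have a: "a \<in> carrier R" "\<one> \<ominus> a \<in> Units R" using assms by blast+
  have i: "i \<in> carrier R" using assms(4) by (rule I.Icarr)
  have "(\<one> \<ominus> a) \<otimes> s = s \<ominus> a \<otimes> s"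
    using a assms(6) by (simp add: a_minus_def l_distr l_minus)
  also have "\<dots> = i"
  proof -
    have "s \<ominus> a \<otimes> s = (i \<oplus> a \<otimes> s) \<ominus> a \<otimes> s"
      by (rule arg_cong[OF assms(7), of "\<lambda>z. z \<ominus> a \<otimes> s"])
    then show ?thesis using a i assms(6) by (simp add: a_minus_def a_assoc r_neg)
  qed
  finally have "(\<one> \<ominus> a) \<otimes> s = i" .
  then have "inv (\<one> \<ominus> a) \<otimes> i = s"
    using a assms(6) by (auto simp: m_assoc[symmetric])
  then show ?thesis using I.I_l_closed[OF assms(4), of "inv (\<one> \<ominus> a)"] a by simp
qed

lemma (in cring) mult_principal_ideal:
  assumes "ideal J R" "s \<in> carrier R" "x \<in> J \<cdot> (PIdl s)"
  shows "\<exists>a\<in>J. x = a \<otimes> s"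
proof -
  interpret J: ideal J R by fact
  show ?thesis
    using assms(3)
  proof (induction rule: ideal_prod.induct)
    case (prod i j)
    then obtain r where "r \<in> carrier R" "j = r \<otimes> s" by (auto simp: cgenideal_def)
    with prod show ?case
      using assms(2) by (intro bexI[of _ "i \<otimes> r"]) (auto simp: m_assoc J.Icarr J.I_r_closed)
  next
    case (sum x y)
    then show ?case using assms(2) by (metis J.Icarr J.a_closed l_distr)
  qed
qed

lemma (in ring) ideal_prod_mono:
  assumes "K \<subseteq> L" shows "J \<cdot> K \<subseteq> J \<cdot> L"
proof
  show "x \<in> J \<cdot> L" if "x \<in> J \<cdot> K" for x
    using that by (induction rule: ideal_prod.induct) (use assms in \<open>auto intro: ideal_prod.intros\<close>)
qed

text \<open>
  The lemma is stated for the finite set of generators \<open>S\<close> rather than for the ideal that they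
  generate, since it is proved by induction on \<open>S\<close> for all \<open>I\<close> at once: the hypothesis for \<open>S\<close> and
  \<open>s\<close> implies the hypothesis for \<open>S\<close> alone relative to the larger ideal \<open>I + (s)\<close>. This puts \<open>S\<close>
  into \<open>I + (s)\<close>, which turns the equation for \<open>s\<close> into \<open>s = i + a s\<close> with \<open>i\<close> in \<open>I\<close> and \<open>a\<close> in \<open>J\<close>,
  and \<open>1 - a\<close> is a unit.
\<close>

lemma (in cring) nakayama:
  assumes J: "ideal J R" "\<And>a. a \<in> J \<Longrightarrow> \<one> \<ominus> a \<in> Units R"
    and "finite S" "S \<subseteq> carrier R" "ideal I R" "S \<subseteq> I <+>\<^bsub>R\<^esub> J \<cdot> (Idl S)"
  shows "S \<subseteq> I"
  using assms(3-)
proof (induction S arbitrary: I rule: finite_induct)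
  case empty
  then show ?case by simp
next
  case (insert s S)
  interpret J: ideal J R by fact
  interpret I: ideal I R by fact
  have s: "s \<in> carrier R" and S: "S \<subseteq> carrier R" using insert.prems by auto
  note ideals = \<open>ideal J R\<close> \<open>ideal I R\<close> cgenideal_ideal[OF s] genideal_ideal[OF S]
  have "Idl (insert s S) \<subseteq> (PIdl s) <+>\<^bsub>R\<^esub> (Idl S)"
  proof (rule genideal_minimal[OF add_ideals[OF ideals(3,4)]])
    have "s \<in> PIdl s" "S \<subseteq> Idl S" by (auto simp: cgenideal_self s genideal_self S)
    moreover have "\<zero> \<in> PIdl s" "\<zero> \<in> Idl S"
      using ideals(3,4) by (simp_all add: additive_subgroup.zero_closed ideal.axioms(1))
    moreover have "s = s \<oplus> \<zero>" "\<And>t. t \<in> S \<Longrightarrow> t = \<zero> \<oplus> t" using s S by auto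
    ultimately show "insert s S \<subseteq> (PIdl s) <+>\<^bsub>R\<^esub> (Idl S)"
      unfolding set_add_def' by blast
  qed
  then have "J \<cdot> (Idl (insert s S)) \<subseteq> J \<cdot> (PIdl s) <+>\<^bsub>R\<^esub> J \<cdot> (Idl S)"
    unfolding ideal_prod_r_distr[OF ideals(1,3,4), symmetric] by (rule ideal_prod_mono)
  then have dec: "\<exists>i\<in>I. \<exists>a\<in>J. \<exists>y\<in>J \<cdot> (Idl S). t = i \<oplus> (a \<otimes> s \<oplus> y)" if "t \<in> insert s S" for t
    using subsetD[OF insert.prems(3) that] mult_principal_ideal[OF ideals(1) s]
    unfolding set_add_def' by blast
  have yc: "y \<in> carrier R" if "y \<in> J \<cdot> (Idl S)" for y
    using that ideal_prod_in_carrier[OF ideals(1,4)] by blast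
  let ?I = "I <+>\<^bsub>R\<^esub> (PIdl s)"
  have I': "ideal ?I R" by (rule add_ideals[OF ideals(2,3)])
  have "S \<subseteq> ?I <+>\<^bsub>R\<^esub> J \<cdot> (Idl S)"
  proof
    fix t assume "t \<in> S"
    then obtain i a y where *: "i \<in> I" "a \<in> J" "y \<in> J \<cdot> (Idl S)" "t = i \<oplus> (a \<otimes> s \<oplus> y)"
      using dec by blast
    then have "t = (i \<oplus> a \<otimes> s) \<oplus> y" using s yc by (simp add: a_assoc)
    moreover have "i \<oplus> a \<otimes> s \<in> ?I"
      using * unfolding set_add_def' cgenideal_def by (auto dest: J.Icarr)
    ultimately show "t \<in> ?I <+>\<^bsub>R\<^esub> J \<cdot> (Idl S)"
      using * unfolding set_add_def' by blast
  qed
  then have "S \<subseteq> ?I" using insert.IH S I' by blast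
  then have "Idl S \<subseteq> ?I" by (rule genideal_minimal[OF I'])
  then have "J \<cdot> (Idl S) \<subseteq> J \<cdot> I <+>\<^bsub>R\<^esub> J \<cdot> (PIdl s)"
    unfolding ideal_prod_r_distr[OF ideals(1,2,3), symmetric] by (rule ideal_prod_mono)
  moreover have "J \<cdot> I \<subseteq> I" using ideal_prod_inter[OF ideals(1,2)] by blast
  ultimately have dec2: "\<exists>i\<in>I. \<exists>a\<in>J. y = i \<oplus> a \<otimes> s" if "y \<in> J \<cdot> (Idl S)" for y
    using that mult_principal_ideal[OF ideals(1) s] unfolding set_add_def' by blast
  obtain i a y where 1: "i \<in> I" "a \<in> J" "y \<in> J \<cdot> (Idl S)" "s = i \<oplus> (a \<otimes> s \<oplus> y)"
    using dec by blast
  obtain j b where 2: "j \<in> I" "b \<in> J" "y = j \<oplus> b \<otimes> s" using dec2 1 by blast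
  have "s = (i \<oplus> j) \<oplus> (a \<oplus> b) \<otimes> s"
    by (rule trans[OF 1(4)[unfolded 2(3)]]) (use 1 2 s in \<open>simp add: I.Icarr J.Icarr l_distr a_ac\<close>)
  then have "s \<in> I"
    using add_mult_mem_ideal[of I J "i \<oplus> j" "a \<oplus> b" s] J(2) 1(1,2) 2(1,2) s ideals(2) J.a_subset
    by (simp add: I.a_closed J.a_closed)
  then have "PIdl s \<subseteq> I" by (rule cgenideal_minimal[OF ideals(2)])
  then have "?I \<subseteq> I" unfolding set_add_def' by auto
  with \<open>S \<subseteq> ?I\<close> \<open>s \<in> I\<close> show ?case by blast
qed

section \<open>Multi-indices and monomials\<close>

abbreviation monomial_series :: "'n mindex \<Rightarrow> 'n series" where
  "monomial_series k \<equiv> lookup (single k 1)"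

lemma mindex_size_add: "mindex_size (j + k) = mindex_size j + mindex_size k"
  by (simp add: mindex_size_def lookup_add sum.distrib)

lemma mindex_size_eq_0_iff: "mindex_size j = 0 \<longleftrightarrow> j = 0"
  by (auto simp: mindex_size_def poly_mapping_eq_iff fun_eq_iff)

lemma finite_mindex_size_le: "finite {j :: 'n::finite mindex. mindex_size j \<le> n}"
proof -
  have "lookup j i \<le> n" if "mindex_size j \<le> n" for i and j :: "'n mindex"
    using that member_le_sum[of i UNIV "lookup j"] by (simp add: mindex_size_def)
  then have "lookup ` {j :: 'n mindex. mindex_size j \<le> n} \<subseteq> PiE UNIV (\<lambda>_. {..n})" by auto
  then have "finite (lookup ` {j :: 'n mindex. mindex_size j \<le> n})"
    by (rule finite_subset) (intro finite_PiE, auto)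
  then show ?thesis by (rule finite_imageD) (auto intro!: inj_onI poly_mapping_eqI)
qed

lemma obtain_mindex_of_size:
  assumes "n \<le> mindex_size (m :: 'n::finite mindex)"
  obtains j k where "m = j + k" "mindex_size j = n"
  using assms
proof (induction n arbitrary: thesis)
  case 0
  then show ?case by (metis add_0 mindex_size_eq_0_iff)
next
  case (Suc n)
  then obtain j k where jk: "m = j + k" "mindex_size j = n" by (metis Suc_leD)
  then have "k \<noteq> 0" using Suc.prems(2) mindex_size_eq_0_iff[of k] by (auto simp: mindex_size_add)
  then obtain i where i: "lookup k i \<noteq> 0" by (auto simp: poly_mapping_eq_iff fun_eq_iff)
  then have "k = single i 1 + (k - single i 1)"
    by (intro poly_mapping_eqI) (auto simp: lookup_add lookup_minus lookup_single when_def)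
  then have "m = (j + single i 1) + (k - single i 1)" using jk by (metis add.assoc)
  moreover have "mindex_size (j + single i 1) = Suc n"
    using jk by (simp add: mindex_size_add) (simp add: mindex_size_def lookup_single when_def)
  ultimately show ?case using Suc.prems(1) by blast
qed

lemma finite_mindex_summands: "finite {k. \<exists>l. k + l = (m :: 'n::finite mindex)}"
proof -
  have "{k. \<exists>l. k + l = m} = fst ` {(k, l). k + l = m}" by force
  then show ?thesis using finite_mindex_splits[of m] by simp
qed

lemma series_mult_monomial:
  fixes f :: "'n::finite series"
  shows "series_mult (monomial_series k) f (k + l) = f l"
proof -
  have "series_mult (monomial_series k) f (k + l) = (\<Sum>z\<in>{(k, l)}. lookup (single k 1) (fst z) * f (snd z))"
    unfolding series_mult_def
    by (rule sum.mono_neutral_cong_right)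
      (auto simp: lookup_single when_def finite_mindex_splits split: if_splits)
  then show ?thesis by simp
qed

lemma series_mult_monomial_0:
  "\<nexists>l. k + l = m \<Longrightarrow> series_mult (monomial_series k) f m = 0"
  unfolding series_mult_def by (rule sum.neutral) (auto simp: lookup_single when_def)

text \<open>
  A product of series is an infinite combination of monomial multiples of \<open>f\<close>, but each of its
  coefficients involves only finitely many of them.
\<close>

lemma series_mult_eq_sum_monomials:
  fixes f h :: "'n::finite series"
  assumes "finite L" "{k. \<exists>l. k + l = m} \<subseteq> L"
  shows "series_mult h f m = (\<Sum>k\<in>L. h k * series_mult (monomial_series k) f m)"
proof -
  have "series_mult h f m = (\<Sum>(k, l)\<in>{(k, l). k + l = m}. h k * series_mult (monomial_series k) f m)"
    unfolding series_mult_def[of h] by (rule sum.cong) (auto simp: series_mult_monomial)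
  also have "\<dots> = (\<Sum>k\<in>{k. \<exists>l. k + l = m}. h k * series_mult (monomial_series k) f m)"
    by (rule sum.reindex_bij_witness[of _ "\<lambda>k. (k, m - k)" fst]) auto
  also have "\<dots> = (\<Sum>k\<in>L. h k * series_mult (monomial_series k) f m)"
    using assms by (intro sum.mono_neutral_left) (auto simp: series_mult_monomial_0)
  finally show ?thesis .
qed

section \<open>Majorants of convergent power series\<close>

text \<open>
  Bounds the weighted \<open>l\<^sup>1\<close> norm of \<open>f\<close> by \<open>C\<close>, for the polyradius with all entries equal to \<open>r\<close>. Finite
  partial sums keep the estimates below free of summability conditions.
\<close>

definition diag_bounded :: "real \<Rightarrow> real \<Rightarrow> 'n::finite series \<Rightarrow> bool" where
  "diag_bounded r C f \<longleftrightarrow> (\<forall>F. finite F \<longrightarrow> (\<Sum>m\<in>F. norm (f m) * r ^ mindex_size m) \<le> C)"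

lemma norm_monom_eval_le:
  assumes "\<And>i. norm (x $ i) \<le> r"
  shows "norm (monom_eval m x) \<le> r ^ mindex_size m"
  unfolding monom_eval_def mindex_size_def prod_norm[symmetric] norm_power power_sum
  using assms by (intro prod_mono) (auto intro: power_mono)

text \<open>
  A neighbourhood of \<open>0\<close> contains a point \<open>(r, \<dots>, r)\<close> with \<open>r > 0\<close>, and by comparison convergence at
  that point implies convergence on the polydisc of radius \<open>r\<close>.
\<close>

lemma convergent_series_iff_diag_bounded:
  fixes f :: "'n::finite series"
  shows "convergent_series f \<longleftrightarrow> (\<exists>r>0. \<exists>C. diag_bounded r C f)"
proof
  assume "convergent_series f"
  then obtain U where U: "open U" "0 \<in> U"
    "\<And>x. x \<in> U \<Longrightarrow> (\<lambda>m. f m * monom_eval m x) summable_on UNIV"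
    unfolding convergent_series_def by blast
  have "((\<lambda>t. (\<chi> i. of_real t) :: complex ^ 'n) \<longlongrightarrow> (\<chi> i. 0)) (at_right (0::real))"
    by (intro tendsto_vec_lambda) (auto intro!: tendsto_eq_intros)
  moreover have "(\<chi> i. 0) = (0 :: complex ^ 'n)" by (simp add: vec_eq_iff)
  ultimately have "\<forall>\<^sub>F t in at_right 0. (\<chi> i. of_real t) \<in> U"
    using U(1,2) by (simp add: topological_tendstoD)
  then have "\<forall>\<^sub>F t in at_right (0::real). 0 < t \<and> (\<chi> i. of_real t) \<in> U"
    by (intro eventually_conj eventually_at_right_less)
  then obtain r :: real where r: "0 < r" "(\<chi> i. of_real r) \<in> U"
    using eventually_happens'[OF trivial_limit_at_right_real] by blast
  have "norm (f m * monom_eval m (\<chi> i. of_real r)) = norm (f m) * r ^ mindex_size m" for m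
    using r(1) by (simp add: norm_mult monom_eval_def mindex_size_def power_sum prod_norm[symmetric] norm_power)
  then have "(\<lambda>m. norm (f m) * r ^ mindex_size m) summable_on UNIV"
    using U(3)[OF r(2)] unfolding summable_on_iff_abs_summable_on_complex by simp
  then have "diag_bounded r (\<Sum>\<^sub>\<infinity>m. norm (f m) * r ^ mindex_size m) f"
    unfolding diag_bounded_def using r(1) by (intro allI impI finite_sum_le_infsum) auto
  then show "\<exists>r>0. \<exists>C. diag_bounded r C f" using r(1) by blast
next
  assume "\<exists>r>0. \<exists>C. diag_bounded r C f"
  then obtain r C where r: "0 < r" and C: "diag_bounded r C f" by blast
  have summable: "(\<lambda>m. norm (f m) * r ^ mindex_size m) summable_on UNIV"
    using C r unfolding diag_bounded_def
    by (intro nonneg_bdd_above_summable_on) (auto intro!: bdd_aboveI[of _ C])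
  let ?U = "{x :: complex ^ 'n. \<forall>i. norm (x $ i) < r}"
  have "?U = (\<Inter>i. {x. norm (x $ i) < r})" by auto
  moreover have "open (\<Inter>i. {x :: complex ^ 'n. norm (x $ i) < r})"
    by (intro open_INT) (auto intro!: open_Collect_less continuous_intros)
  ultimately have "open ?U" by simp
  moreover have "(\<lambda>m. f m * monom_eval m x) summable_on UNIV" if "x \<in> ?U" for x
  proof (rule Infinite_Sum.abs_summable_summable, rule Infinite_Sum.abs_summable_on_comparison_test)
    show "(\<lambda>m. norm (norm (f m) * r ^ mindex_size m)) summable_on UNIV" using summable r by simp
    show "norm (f m * monom_eval m x) \<le> norm (norm (f m) * r ^ mindex_size m)" for m
      using norm_monom_eval_le[of x r m] that r
      by (auto simp: norm_mult less_imp_le intro!: mult_left_mono)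
  qed
  ultimately show "convergent_series f"
    unfolding convergent_series_def using r by (intro exI[of _ ?U]) auto
qed

lemma diag_bounded_const_1: "diag_bounded r 1 (const_series 1)"
proof -
  have "(\<Sum>m\<in>F. norm (const_series 1 m) * r ^ mindex_size m) \<le> 1" if "finite F" for F :: "'a mindex set"
  proof -
    have "(\<Sum>m\<in>F. norm (const_series 1 m) * r ^ mindex_size m) = (\<Sum>m\<in>F. if m = 0 then 1 else 0)"
      by (intro sum.cong) (auto simp: const_series_def mindex_size_eq_0_iff[THEN iffD2])
    also have "\<dots> \<le> (1::real)" using that by simp
    finally show ?thesis .
  qed
  then show ?thesis by (auto simp: diag_bounded_def)
qed

text \<open>
  The weighted \<open>l\<^sup>1\<close> norm is submultiplicative, because the degree is additive.
\<close>

lemma diag_bounded_mult: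
  fixes f g :: "'n::finite series"
  assumes "0 \<le> r" "diag_bounded r C f" "diag_bounded r D g"
  shows "diag_bounded r (C * D) (series_mult f g)"
proof -
  let ?N = "\<lambda>f m. norm (f m :: complex) * r ^ mindex_size (m :: 'n mindex)"
  let ?S = "\<lambda>m. {(k, l). k + l = (m :: 'n mindex)}"
  have "(\<Sum>m\<in>F. ?N (series_mult f g) m) \<le> C * D" if F: "finite F" for F
  proof -
    let ?T = "\<Union>m\<in>F. ?S m"
    have T: "finite ?T" using F finite_mindex_splits by blast
    have "(\<Sum>m\<in>F. ?N (series_mult f g) m) \<le> (\<Sum>m\<in>F. \<Sum>(k, l)\<in>?S m. ?N f k * ?N g l)"
    proof (rule sum_mono)
      fix m
      have "?N (series_mult f g) m \<le> (\<Sum>z\<in>?S m. norm (f (fst z) * g (snd z))) * r ^ mindex_size m"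
        unfolding series_mult_def case_prod_beta using assms(1) by (intro mult_right_mono norm_sum) auto
      also have "\<dots> = (\<Sum>(k, l)\<in>?S m. ?N f k * ?N g l)"
        unfolding sum_distrib_right
        by (intro sum.cong) (auto simp: norm_mult mindex_size_add power_add)
      finally show "?N (series_mult f g) m \<le> (\<Sum>(k, l)\<in>?S m. ?N f k * ?N g l)" .
    qed
    also have "\<dots> = (\<Sum>(k, l)\<in>?T. ?N f k * ?N g l)"
      using F finite_mindex_splits by (intro sum.UNION_disjoint[symmetric]) auto
    also have "\<dots> \<le> (\<Sum>(k, l)\<in>fst ` ?T \<times> snd ` ?T. ?N f k * ?N g l)"
    proof (rule sum_mono2)
      show "finite (fst ` ?T \<times> snd ` ?T)" using T by blast
      show "?T \<subseteq> fst ` ?T \<times> snd ` ?T" by (rule subset_fst_snd)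
    qed (use assms(1) in auto)
    also have "\<dots> = (\<Sum>k\<in>fst ` ?T. ?N f k) * (\<Sum>l\<in>snd ` ?T. ?N g l)"
      by (simp add: sum_product sum.cartesian_product)
    also have "\<dots> \<le> C * D"
    proof (rule mult_mono)
      show "(\<Sum>k\<in>fst ` ?T. ?N f k) \<le> C" "(\<Sum>l\<in>snd ` ?T. ?N g l) \<le> D"
        using assms(2,3) T unfolding diag_bounded_def by blast+
      show "0 \<le> C" using assms(2) unfolding diag_bounded_def by (metis finite.emptyI sum.empty)
    qed (use assms(1) in \<open>auto intro: sum_nonneg\<close>)
    finally show ?thesis .
  qed
  then show ?thesis by (simp add: diag_bounded_def)
qed

text \<open>
  Scaling the radius by \<open>t \<le> 1\<close> scales every term of positive degree by at most \<open>t\<close>, and a series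
  without constant term has no other terms.
\<close>

lemma diag_bounded_shrink:
  assumes "0 < r" "diag_bounded r C f" "f 0 = 0" "0 < \<epsilon>"
  obtains s where "0 < s" "diag_bounded s \<epsilon> f"
proof
  have C: "0 \<le> C" using assms(2) unfolding diag_bounded_def by (metis finite.emptyI sum.empty)
  \<comment> \<open>Chosen with \<open>?t * C \<le> \<epsilon>\<close>; the \<open>\<epsilon>\<close> in the denominator covers \<open>C = 0\<close>.\<close>
  let ?t = "\<epsilon> / (C + \<epsilon>)"
  have t: "0 < ?t" "?t \<le> 1" using C assms(4) by auto
  show "0 < r * ?t" using assms(1) t(1) by (rule mult_pos_pos)
  have *: "norm (f m) * (r * ?t) ^ mindex_size m \<le> ?t * (norm (f m) * r ^ mindex_size m)" for m
  proof (cases "m = 0")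
    case False
    then have "?t ^ mindex_size m \<le> ?t ^ 1"
      using t mindex_size_eq_0_iff[of m] by (intro power_decreasing) auto
    then have "norm (f m) * r ^ mindex_size m * ?t ^ mindex_size m \<le> norm (f m) * r ^ mindex_size m * ?t"
      using assms(1) by (intro mult_left_mono) auto
    then show ?thesis unfolding power_mult_distrib by (simp only: mult_ac)
  qed (simp add: assms(3))
  show "diag_bounded (r * ?t) \<epsilon> f"
    unfolding diag_bounded_def
  proof (intro allI impI)
    fix F :: "'a mindex set" assume F: "finite F"
    have "(\<Sum>m\<in>F. norm (f m) * (r * ?t) ^ mindex_size m)
        \<le> ?t * (\<Sum>m\<in>F. norm (f m) * r ^ mindex_size m)"
      unfolding sum_distrib_left by (intro sum_mono *)
    also have "\<dots> \<le> ?t * C" using assms(2) F t unfolding diag_bounded_def by (intro mult_left_mono) auto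
    also have "\<dots> \<le> \<epsilon>" using C assms(4) by (simp add: field_simps)
    finally show "(\<Sum>m\<in>F. norm (f m) * (r * ?t) ^ mindex_size m) \<le> \<epsilon>" .
  qed
qed

definition series_power :: "'n::finite series \<Rightarrow> nat \<Rightarrow> 'n series" where
  "series_power a n = (series_mult a ^^ n) (const_series 1)"

text \<open>
  The sum \<open>1 + a + a\<^sup>2 + \<dots>\<close> for a series \<open>a\<close> without constant term. Powers \<open>a\<^sup>n\<close> with \<open>n\<close> larger than
  the degree of \<open>m\<close> do not contribute to the coefficient at \<open>m\<close>, which makes every coefficient a finite sum.
\<close>

definition geometric_series :: "'n::finite series \<Rightarrow> 'n series" where
  "geometric_series a m = (\<Sum>n\<le>mindex_size m. series_power a n m)"

lemma series_power_simps [simp]: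
  "series_power a 0 = const_series 1"
  "series_power a (Suc n) = series_mult a (series_power a n)"
  by (simp_all add: series_power_def)

lemma series_power_order:
  assumes "a 0 = 0" "mindex_size m < n"
  shows "series_power a n m = 0"
  using assms(2)
proof (induction n arbitrary: m)
  case (Suc n)
  have "a k * series_power a n l = 0" if "k + l = m" for k l
  proof (cases "k = 0")
    case False
    then have "mindex_size l < n"
      using that Suc.prems mindex_size_eq_0_iff[of k] by (auto simp: mindex_size_add)
    then show ?thesis by (simp add: Suc.IH)
  qed (simp add: assms(1))
  then show ?case by (auto simp: series_mult_def intro!: sum.neutral)
qed simp

lemma geometric_series_eq:
  assumes "a 0 = 0" "mindex_size m \<le> N"
  shows "geometric_series a m = (\<Sum>n\<le>N. series_power a n m)"
  unfolding geometric_series_def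
  using assms by (intro sum.mono_neutral_left) (auto simp: series_power_order)

lemma geometric_series_inverse:
  assumes "a 0 = 0"
  shows "geometric_series a m - series_mult a (geometric_series a) m = const_series 1 m"
proof -
  let ?M = "mindex_size m"
  have "series_mult a (geometric_series a) m
      = (\<Sum>(k, l)\<in>{(k, l). k + l = m}. \<Sum>n\<le>?M. a k * series_power a n l)"
    unfolding series_mult_def[of a "geometric_series a"]
    by (intro sum.cong) (auto simp: geometric_series_eq[where a = a and N = ?M, OF assms] mindex_size_add sum_distrib_left)
  also have "\<dots> = (\<Sum>n\<le>?M. series_power a (Suc n) m)"
    unfolding series_power_simps(2) series_mult_def split_def by (rule sum.swap)
  finally have "geometric_series a m - series_mult a (geometric_series a) m
      = (\<Sum>n\<le>?M. series_power a n m - series_power a (Suc n) m)"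
    by (simp only: geometric_series_def sum_subtractf)
  also have "\<dots> = series_power a 0 m - series_power a (Suc ?M) m"
    by (rule sum_telescope)
  also have "\<dots> = const_series 1 m"
    using series_power_order[where a = a, OF assms, of m "Suc ?M"] by (simp del: series_power_simps(2))
  finally show ?thesis .
qed

text \<open>
  On a polydisc so small that \<open>a\<close> has norm at most \<open>1/2\<close>, the powers of \<open>a\<close> are dominated by
  the numerical geometric series.
\<close>

lemma convergent_geometric_series:
  assumes "convergent_series a" "a 0 = 0"
  shows "convergent_series (geometric_series a)"
proof -
  obtain s where s: "0 < s" "diag_bounded s (1 / 2) a"
    using assms diag_bounded_shrink[of _ _ a "1 / 2"]
    unfolding convergent_series_iff_diag_bounded by (metis zero_less_divide_1_iff zero_less_numeral)
  have pow: "diag_bounded s ((1 / 2) ^ n) (series_power a n)" for n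
    by (induction n) (use diag_bounded_mult[OF _ s(2)] s(1) in \<open>auto simp: diag_bounded_const_1\<close>)
  have "(\<Sum>m\<in>F. norm (geometric_series a m) * s ^ mindex_size m) \<le> 2" if F: "finite F" for F
  proof -
    obtain N where N: "\<And>m. m \<in> F \<Longrightarrow> mindex_size m \<le> N"
      using finite_nat_set_iff_bounded_le[of "mindex_size ` F"] F by auto
    have "(\<Sum>m\<in>F. norm (geometric_series a m) * s ^ mindex_size m)
        \<le> (\<Sum>m\<in>F. \<Sum>n\<le>N. norm (series_power a n m) * s ^ mindex_size m)"
      unfolding sum_distrib_right[symmetric]
    proof (intro sum_mono mult_right_mono)
      show "norm (geometric_series a m) \<le> (\<Sum>n\<le>N. norm (series_power a n m))" if "m \<in> F" for m
        unfolding geometric_series_eq[where a = a and N = N, OF assms(2) N[OF that]] by (rule norm_sum)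
    qed (use s(1) in auto)
    also have "\<dots> = (\<Sum>n\<le>N. \<Sum>m\<in>F. norm (series_power a n m) * s ^ mindex_size m)"
      by (rule sum.swap)
    also have "\<dots> \<le> (\<Sum>n\<le>N. (1 / 2) ^ n)"
      using pow F unfolding diag_bounded_def by (intro sum_mono) blast
    also have "\<dots> = 2 - (1 / 2) ^ N" by (induction N) auto
    also have "\<dots> \<le> 2" by simp
    finally show ?thesis .
  qed
  then show ?thesis
    unfolding convergent_series_iff_diag_bounded diag_bounded_def using s(1) by blast
qed

text \<open>
  Every monomial of degree at least \<open>k\<close> is assigned to one of its divisors of degree \<open>k\<close>. The
  terms of \<open>f\<close> assigned to \<open>l\<close> make up the multiple \<open>x\<^sup>l g\<^sub>l\<close>; as \<open>g\<^sub>l\<close> consists of shifted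
  coefficients of \<open>f\<close>, it inherits the majorant of \<open>f\<close>. The values \<open>g\<^sub>l(0)\<close> are recorded because they
  vanish when \<open>f\<close> has order larger than \<open>k\<close>, which places the coefficients in the maximal ideal.
\<close>

lemma divide_by_monomials:
  fixes f :: "'n::finite series"
  assumes "convergent_series f" "\<And>m. mindex_size m < k \<Longrightarrow> f m = 0"
  shows "\<exists>g. (\<forall>l. convergent_series (g l)) \<and> (\<forall>l. mindex_size l = k \<longrightarrow> g l 0 = f l) \<and>
    (\<forall>m. f m = (\<Sum>l | mindex_size l = k. series_mult (monomial_series l) (g l) m))"
proof -
  let ?L = "{l :: 'n mindex. mindex_size l = k}"
  have L: "finite ?L" by (rule finite_subset[OF _ finite_mindex_size_le[of k]]) auto
  have "\<exists>j. mindex_size j = k \<and> (\<exists>l. j + l = m)" if "k \<le> mindex_size m" for m :: "'n mindex"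
    using obtain_mindex_of_size[OF that] by metis
  then obtain \<phi> where \<phi>: "\<And>m :: 'n mindex. k \<le> mindex_size m \<Longrightarrow> mindex_size (\<phi> m) = k \<and> (\<exists>l. \<phi> m + l = m)"
    by metis
  define g where "g l n = (if \<phi> (l + n) = l then f (l + n) else 0)" for l n
  obtain r C where r: "0 < r" "diag_bounded r C f"
    using assms(1) unfolding convergent_series_iff_diag_bounded by blast
  show ?thesis
  proof (intro exI[of _ g] conjI allI impI)
    show "convergent_series (g l)" for l
    proof -
      have "(\<Sum>n\<in>F. norm (g l n) * r ^ mindex_size n) \<le> C / r ^ mindex_size l" if F: "finite F" for F
      proof -
        have "r ^ mindex_size l * (\<Sum>n\<in>F. norm (g l n) * r ^ mindex_size n)
            \<le> (\<Sum>n\<in>F. norm (f (l + n)) * r ^ mindex_size (l + n))"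
          unfolding sum_distrib_left using r(1)
          by (intro sum_mono) (auto simp: g_def mindex_size_add power_add)
        also have "\<dots> = (\<Sum>m\<in>(\<lambda>n. l + n) ` F. norm (f m) * r ^ mindex_size m)"
          by (simp add: sum.reindex)
        also have "\<dots> \<le> C" using r(2) F unfolding diag_bounded_def by blast
        finally show ?thesis using r(1) by (simp add: field_simps)
      qed
      then show ?thesis
        unfolding convergent_series_iff_diag_bounded diag_bounded_def using r(1) by blast
    qed
    show "g l 0 = f l" if "mindex_size l = k" for l
    proof -
      have "\<phi> l = l"
        using \<phi>[of l] that mindex_size_eq_0_iff by (metis add.right_neutral add_left_cancel le_refl mindex_size_add)
      then show ?thesis by (simp add: g_def)
    qed
    show "f m = (\<Sum>l\<in>?L. series_mult (monomial_series l) (g l) m)" for m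
    proof (cases "k \<le> mindex_size m")
      case True
      have "series_mult (monomial_series l) (g l) m = (if l = \<phi> m then f m else 0)" for l
      proof (cases "\<exists>n. l + n = m")
        case True
        then show ?thesis by (auto simp: series_mult_monomial g_def)
      next
        case False
        then show ?thesis using \<phi>[OF True] by (auto simp: series_mult_monomial_0)
      qed
      then show ?thesis using \<phi>[OF True] L by simp
    next
      case False
      then have "\<nexists>n. l + n = m" if "l \<in> ?L" for l
        using that by (auto simp: mindex_size_add)
      then show ?thesis
        using False assms(2) by (simp add: series_mult_monomial_0)
    qed
  qed
qed

section \<open>Ideals of convergent power series\<close>

lemma series_ring_simps [simp]:
  "carrier series_ring = {f. convergent_series f}"
  "f \<otimes>\<^bsub>series_ring\<^esub> g = series_mult f g" "f \<oplus>\<^bsub>series_ring\<^esub> g = (\<lambda>m. f m + g m)"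
  "\<one>\<^bsub>series_ring\<^esub> = const_series 1" "\<zero>\<^bsub>series_ring\<^esub> = (\<lambda>m. 0)"
  by (auto simp: series_ring_def const_series_def)

lemma convergent_series_scale: "convergent_series f \<Longrightarrow> convergent_series (\<lambda>m. b * f m)"
  using convergent_series_mult[OF convergent_series_const] by (simp add: series_mult_const)

lemma series_ring_a_inv:
  assumes "convergent_series f"
  shows "\<ominus>\<^bsub>series_ring\<^esub> f = (\<lambda>m. - f m)"
proof -
  interpret cring series_ring by (rule cring_series_ring)
  show ?thesis
    using assms convergent_series_scale[of f "- 1"] by (intro minus_equality) auto
qed

lemma ideal_series_ringI:
  assumes "\<And>f. f \<in> I \<Longrightarrow> convergent_series f" "(\<lambda>m. 0) \<in> I"
    and "\<And>f g. f \<in> I \<Longrightarrow> g \<in> I \<Longrightarrow> (\<lambda>m. f m + g m) \<in> I"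
    and "\<And>f h. f \<in> I \<Longrightarrow> convergent_series h \<Longrightarrow> series_mult h f \<in> I"
  shows "ideal I series_ring"
proof -
  interpret cring series_ring by (rule cring_series_ring)
  have "(\<lambda>m. - f m) \<in> I" if "f \<in> I" for f
    using assms(4)[OF that convergent_series_const[of "- 1"]] by (simp add: series_mult_const)
  then have "subgroup I (add_monoid series_ring)"
    using assms by (intro add.subgroupI) (auto simp: series_ring_a_inv simp flip: a_inv_def)
  then show ?thesis
    using assms(4) by (intro idealI ring_axioms) (auto simp: series_mult_commute[of _ "_ :: 'a series"])
qed

lemma
  assumes "ideal I series_ring"
  shows series_ideal_convergent: "f \<in> I \<Longrightarrow> convergent_series f"
    and series_ideal_zero: "(\<lambda>m. 0) \<in> I"
    and series_ideal_add: "f \<in> I \<Longrightarrow> g \<in> I \<Longrightarrow> (\<lambda>m. f m + g m) \<in> I"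
    and series_ideal_mult: "f \<in> I \<Longrightarrow> convergent_series h \<Longrightarrow> series_mult h f \<in> I"
    and series_ideal_scale: "f \<in> I \<Longrightarrow> (\<lambda>m. b * f m) \<in> I"
proof -
  interpret ideal I series_ring by fact
  show "f \<in> I \<Longrightarrow> convergent_series f" using Icarr[of f] by simp
  show "(\<lambda>m. 0) \<in> I" using additive_subgroup.zero_closed[OF is_additive_subgroup] by simp
  show "f \<in> I \<Longrightarrow> g \<in> I \<Longrightarrow> (\<lambda>m. f m + g m) \<in> I" using additive_subgroup.a_closed[OF is_additive_subgroup, of f g] by simp
  show *: "f \<in> I \<Longrightarrow> convergent_series h \<Longrightarrow> series_mult h f \<in> I" for h using I_l_closed[of f h] by simp
  show "f \<in> I \<Longrightarrow> (\<lambda>m. b * f m) \<in> I"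
    using *[OF _ convergent_series_const[of b]] by (simp add: series_mult_const)
qed

lemma series_ideal_sum:
  assumes "ideal I series_ring" "\<And>l. l \<in> L \<Longrightarrow> \<phi> l \<in> I"
  shows "(\<lambda>m. \<Sum>l\<in>L. \<phi> l m) \<in> I"
  using assms(2)
  by (induction L rule: infinite_finite_induct)
    (auto simp: series_ideal_zero[OF assms(1)] intro: series_ideal_add[OF assms(1)])

lemma ideal_maximal: "ideal {f. convergent_series f \<and> f 0 = 0} series_ring"
proof (rule ideal_series_ringI)
  have "series_mult h f 0 = h 0 * f 0" for h f :: "'a series"
  proof -
    have "{(k, l). k + l = (0 :: 'a mindex)} = {(0, 0)}"
      by (auto, (metis add_is_0 mindex_size_add mindex_size_eq_0_iff)+)
    then show ?thesis by (simp add: series_mult_def)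
  qed
  then show "series_mult h f \<in> {f. convergent_series f \<and> f 0 = 0}"
    if "f \<in> {f. convergent_series f \<and> f 0 = 0}" "convergent_series h" for f h :: "'a series"
    using that by (auto simp: convergent_series_mult)
  show "(\<lambda>m. 0) \<in> {f :: 'a series. convergent_series f \<and> f 0 = 0}"
    using convergent_series_scale[OF convergent_series_const, of 0] by simp
qed (auto simp: convergent_series_add)

lemma one_minus_maximal_unit:
  assumes "convergent_series a" "a 0 = 0"
  shows "\<one>\<^bsub>series_ring\<^esub> \<ominus>\<^bsub>series_ring\<^esub> a \<in> Units series_ring"
proof -
  interpret cring series_ring by (rule cring_series_ring)
  let ?g = "geometric_series a"
  have g: "?g \<in> carrier series_ring" using convergent_geometric_series[OF assms] by simp
  have a: "a \<in> carrier series_ring" using assms by simp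
  have "(\<one>\<^bsub>series_ring\<^esub> \<ominus>\<^bsub>series_ring\<^esub> a) \<otimes>\<^bsub>series_ring\<^esub> ?g
      = ?g \<ominus>\<^bsub>series_ring\<^esub> a \<otimes>\<^bsub>series_ring\<^esub> ?g"
    using a g unfolding a_minus_def by (simp only: l_distr l_minus one_closed a_inv_closed l_one)
  also have "\<dots> = (\<lambda>m. ?g m - series_mult a ?g m)"
    using a g unfolding a_minus_def by (simp add: series_ring_a_inv convergent_series_mult)
  also have "\<dots> = \<one>\<^bsub>series_ring\<^esub>"
    using geometric_series_inverse[where a = a, OF assms(2)] by (simp add: fun_eq_iff)
  finally have *: "(\<one>\<^bsub>series_ring\<^esub> \<ominus>\<^bsub>series_ring\<^esub> a) \<otimes>\<^bsub>series_ring\<^esub> ?g = \<one>\<^bsub>series_ring\<^esub>" .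
  show ?thesis
    unfolding Units_def
    by (intro CollectI conjI bexI[of _ ?g] minus_closed one_closed a g *)
      (simp only: m_comm[OF g minus_closed[OF one_closed a]] *)
qed

section \<open>Taylor coefficients of polynomials\<close>

lemma sum_single_lookup: "(\<Sum>i\<in>UNIV. single i (lookup j i)) = (j :: 'n::finite mindex)"
proof (rule poly_mapping_eqI)
  fix k
  have "lookup (\<Sum>i\<in>UNIV. single i (lookup j i)) k = (\<Sum>i\<in>UNIV. if i = k then lookup j k else 0)"
    unfolding lookup_sum by (intro sum.cong) (auto simp: lookup_single when_def)
  then show "lookup (\<Sum>i\<in>UNIV. single i (lookup j i)) k = lookup j k" by simp
qed

lemma lookup_partial_deriv_funpow:
  "lookup ((partial_deriv i ^^ n) p) k
    = fact (lookup k i + n) / fact (lookup k i) * lookup p (k + single i n)"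
proof (induction n arbitrary: k)
  case (Suc n)
  have "k + single i 1 + single i n = k + single i (Suc n)"
    by (intro poly_mapping_eqI) (auto simp: lookup_add lookup_single when_def)
  then show ?case
    by (simp add: lookup_partial_deriv Suc.IH lookup_add field_simps del: of_nat_Suc)
qed simp

lemma lookup_iter_deriv:
  "lookup (iter_deriv j p) k
    = (\<Prod>i\<in>UNIV. fact (lookup k i + lookup j i) / fact (lookup k i)) * lookup p (k + j)"
proof -
  interpret comp_fun_commute "\<lambda>i. partial_deriv i ^^ lookup j i"
    by (rule comp_fun_commute_partial_deriv)
  have "lookup (Finite_Set.fold (\<lambda>i. partial_deriv i ^^ lookup j i) p A) k
      = (\<Prod>i\<in>A. fact (lookup k i + lookup j i) / fact (lookup k i))
        * lookup p (k + (\<Sum>i\<in>A. single i (lookup j i)))" if "finite A" for A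
    using that
  proof (induction A arbitrary: k rule: finite_induct)
    case (insert i A)
    have "(\<Prod>i'\<in>A. fact (lookup (k + single i (lookup j i)) i' + lookup j i')
          / fact (lookup (k + single i (lookup j i)) i') :: complex)
        = (\<Prod>i'\<in>A. fact (lookup k i' + lookup j i') / fact (lookup k i'))"
      using insert.hyps by (intro prod.cong) (auto simp: lookup_add lookup_single when_def)
    then show ?case
      using insert by (simp add: lookup_partial_deriv_funpow add.assoc)
  qed simp
  from this[of UNIV] show ?thesis by (simp add: iter_deriv_def sum_single_lookup)
qed

lemma single_power: "single (single i k) c ^ n = single (single i (n * k)) (c ^ n :: complex)"
  for k :: nat
  by (induction n) (auto simp: mult_single simp flip: single_add)

lemma prod_single: "(\<Prod>i\<in>A. single (u i) (c i)) = single (\<Sum>i\<in>A. u i) (\<Prod>i\<in>A. c i :: complex)"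
  for u :: "_ \<Rightarrow> 'n mindex"
  by (induction A rule: infinite_finite_induct) (auto simp: mult_single)

lemma linear_factor_power:
  "(single (single i 1) 1 + single 0 b) ^ n
    = (\<Sum>k\<le>n. single (single i k) (of_nat (n choose k) * b ^ (n - k) :: complex))"
  for i :: 'n
proof -
  have "of_nat (n choose k) * single (single i (1::nat)) 1 ^ k * single 0 b ^ (n - k)
      = single (single i k) (of_nat (n choose k) * b ^ (n - k))" for k
    using single_power[of i 0 b "n - k"]
    by (simp add: single_power mult_single flip: single_of_nat)
  then show ?thesis by (simp add: binomial_ring)
qed

lemma lookup_translate:
  fixes a :: "complex ^ 'n::finite"
  shows "lookup (translate a p) j
    = (\<Sum>m\<in>keys p. lookup p m *
        (\<Prod>i\<in>UNIV. of_nat (lookup m i choose lookup j i) * (a $ i) ^ (lookup m i - lookup j i)))"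
proof -
  let ?c = "\<lambda>m i k. of_nat (lookup m i choose k) * (a $ i) ^ (lookup m i - k) :: complex"
  have "lookup (single 0 (lookup p m) * (\<Prod>i\<in>UNIV. (single (single i 1) 1 + single 0 (a $ i)) ^ lookup m i)) j
      = lookup p m * (\<Prod>i\<in>UNIV. ?c m i (lookup j i))" for m
  proof -
    let ?F = "PiE UNIV (\<lambda>i. {..lookup m i})"
    have fin: "finite ?F" by (intro finite_PiE) auto
    have "(\<Prod>i\<in>UNIV. (single (single i 1) 1 + single 0 (a $ i)) ^ lookup m i)
        = (\<Sum>g\<in>?F. single (\<Sum>i\<in>UNIV. single i (g i)) (\<Prod>i\<in>UNIV. ?c m i (g i)))"
      unfolding linear_factor_power by (simp add: prod_sum_PiE prod_single)
    then have "single 0 (lookup p m) * (\<Prod>i\<in>UNIV. (single (single i 1) 1 + single 0 (a $ i)) ^ lookup m i)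
        = (\<Sum>g\<in>?F. single (\<Sum>i\<in>UNIV. single i (g i)) (lookup p m * (\<Prod>i\<in>UNIV. ?c m i (g i))))"
      by (simp add: sum_distrib_left mult_single)
    moreover have "(\<Sum>i\<in>UNIV. single i (g i)) = j \<longleftrightarrow> g = lookup j" for g :: "'n \<Rightarrow> nat"
    proof -
      have "lookup (\<Sum>i\<in>UNIV. single i (g i)) = g"
        using sum_single_lookup[of "Abs_poly_mapping g"] by (simp add: Abs_poly_mapping_inverse)
      then show ?thesis by (metis poly_mapping_eqI)
    qed
    ultimately have "lookup (single 0 (lookup p m) * (\<Prod>i\<in>UNIV. (single (single i 1) 1 + single 0 (a $ i)) ^ lookup m i)) j
        = (\<Sum>g\<in>?F. if g = lookup j then lookup p m * (\<Prod>i\<in>UNIV. ?c m i (g i)) else 0)"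
      by (simp add: lookup_sum lookup_single when_def)
    also have "\<dots> = lookup p m * (\<Prod>i\<in>UNIV. ?c m i (lookup j i))"
    proof (cases "lookup j \<in> ?F")
      case False
      then have "\<not> (\<forall>i. lookup j i \<le> lookup m i)" by auto
      then obtain i where "lookup m i < lookup j i" by (auto simp: not_le)
      then have "(\<Prod>i\<in>UNIV. ?c m i (lookup j i)) = 0"
        by (intro prod_zero) (auto intro: exI[of _ i])
      with False show ?thesis by (simp add: fin sum.delta)
    qed (simp add: fin sum.delta)
    finally show ?thesis .
  qed
  then show ?thesis unfolding translate_def lookup_sum by simp
qed

text \<open>
  Taylor's formula: the normalised partial derivatives at \<open>a\<close> are the coefficients of
  \<open>p(x + a)\<close>. Both sides are computed explicitly, and agree because \<open>(k + j)! / (k! j!)\<close> is a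
  binomial coefficient.
\<close>

lemma diff_symbol_at_eq_lookup_translate: "diff_symbol_at a j p = lookup (translate a p) j"
proof -
  let ?K = "{k. k + j \<in> keys p}"
  let ?t = "\<lambda>m. lookup p m *
        (\<Prod>i\<in>UNIV. of_nat (lookup m i choose lookup j i) * (a $ i) ^ (lookup m i - lookup j i))"
  have inj: "inj_on (\<lambda>k. k + j) ?K" by (auto intro: inj_onI)
  have fin: "finite ?K"
    by (rule finite_imageD[OF finite_subset[OF _ finite_keys[of p]] inj]) auto
  have "keys (iter_deriv j p) \<subseteq> ?K"
    by (auto simp: in_keys_iff lookup_iter_deriv)
  then have "diff_symbol_at a j p
      = (\<Sum>k\<in>?K. lookup (iter_deriv j p) k * monom_eval k a / (\<Prod>i\<in>UNIV. fact (lookup j i)))"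
    unfolding diff_symbol_at_def by (simp add: poly_eval_superset[OF fin] sum_divide_distrib)
  also have "\<dots> = (\<Sum>k\<in>?K. ?t (k + j))"
  proof (rule sum.cong)
    fix k
    have "lookup (iter_deriv j p) k * monom_eval k a / (\<Prod>i\<in>UNIV. fact (lookup j i))
        = lookup p (k + j) * (\<Prod>i\<in>UNIV. fact (lookup k i + lookup j i) / fact (lookup k i)
            * (a $ i) ^ lookup k i / fact (lookup j i))"
      by (simp add: lookup_iter_deriv monom_eval_def prod.distrib prod_dividef)
    also have "\<dots> = ?t (k + j)"
      by (intro arg_cong2[of _ _ _ _ "(*)"] prod.cong)
        (auto simp: lookup_add binomial_fact field_simps)
    finally show "lookup (iter_deriv j p) k * monom_eval k a / (\<Prod>i\<in>UNIV. fact (lookup j i)) = ?t (k + j)" .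
  qed simp
  also have "\<dots> = (\<Sum>m\<in>(\<lambda>k. k + j) ` ?K. ?t m)"
    using inj by (simp add: sum.reindex)
  also have "\<dots> = (\<Sum>m\<in>keys p. ?t m)"
  proof (rule sum.mono_neutral_left)
    show "\<forall>m\<in>keys p - (\<lambda>k. k + j) ` ?K. ?t m = 0"
    proof
      fix m assume m: "m \<in> keys p - (\<lambda>k. k + j) ` ?K"
      have "\<exists>i. lookup m i < lookup j i"
      proof (rule ccontr)
        assume "\<not> ?thesis"
        then have "m = (m - j) + j"
          by (intro poly_mapping_eqI) (auto simp: lookup_add lookup_minus not_less)
        with m show False by (metis (mono_tags, lifting) Diff_iff image_eqI mem_Collect_eq)
      qed
      then show "?t m = 0" by (auto intro!: prod_zero)
    qed
  qed auto
  finally show ?thesis by (simp add: lookup_translate)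
qed

section \<open>The dual space as an annihilator\<close>

text \<open>
  The action of a functional at the origin on a power series: by Taylor's formula the symbol with
  multi-index \<open>j\<close> reads off the coefficient at \<open>j\<close>.
\<close>

definition pairing :: "'n functional \<Rightarrow> 'n series \<Rightarrow> complex" where
  "pairing c f = (\<Sum>j\<in>keys c. lookup c j * f j)"

lemma pairing_superset:
  assumes "finite A" "keys c \<subseteq> A"
  shows "pairing c f = (\<Sum>j\<in>A. lookup c j * f j)"
  unfolding pairing_def using assms by (intro sum.mono_neutral_left) (auto simp: in_keys_iff)

lemma pairing_add_left: "pairing (c + d) f = pairing c f + pairing d f"
proof -
  let ?A = "keys c \<union> keys d"
  have "keys (c + d) \<subseteq> ?A" by (rule Poly_Mapping.keys_add)
  then show ?thesis
    by (subst (1 2 3) pairing_superset[of ?A]) (auto simp: lookup_add algebra_simps sum.distrib)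
qed

lemma pairing_scale_left: "pairing (Poly_Mapping.map ((*) b) c) f = b * pairing c f"
proof -
  have "keys (Poly_Mapping.map ((*) b) c) \<subseteq> keys c" by (auto simp: in_keys_iff lookup_scale)
  then show ?thesis
    by (subst (1 2) pairing_superset[of "keys c"]) (auto simp: lookup_scale sum_distrib_left mult_ac)
qed

lemma pairing_add_right: "pairing c (\<lambda>m. f m + g m) = pairing c f + pairing c g"
  by (simp add: pairing_def algebra_simps sum.distrib)

lemma pairing_scale_right: "pairing c (\<lambda>m. b * f m) = b * pairing c f"
  by (simp add: pairing_def sum_distrib_left mult_ac)

lemma pairing_zero_right: "pairing c (\<lambda>m. 0) = 0"
  by (simp add: pairing_def)

lemma pairing_monomial_series: "pairing c (monomial_series k) = lookup c k"
proof -
  have "pairing c (monomial_series k) = (\<Sum>j\<in>keys c. if j = k then lookup c k else 0)"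
    unfolding pairing_def by (intro sum.cong) (auto simp: lookup_single when_def)
  then show ?thesis by (simp add: in_keys_iff)
qed

lemma series_mult_monomial_monomial:
  "series_mult (monomial_series k) (monomial_series l) = monomial_series (k + l :: 'n::finite mindex)"
proof (rule ext)
  fix m
  show "series_mult (monomial_series k) (monomial_series l) m = monomial_series (k + l) m"
  proof (cases "\<exists>n. k + n = m")
    case True
    then show ?thesis by (auto simp: series_mult_monomial lookup_single when_def)
  next
    case False
    then show ?thesis by (auto simp: series_mult_monomial_0 lookup_single when_def)
  qed
qed

text \<open>
  This adjunction turns a condition on an anti-derivative of \<open>c\<close> into a condition on \<open>c\<close> itself.
\<close>

lemma pairing_anti_diff:
  fixes c :: "'n::finite functional"
  shows "pairing (anti_diff i c) f = pairing c (series_mult (monomial_series (single i 1)) f)"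
proof -
  let ?K = "{k. k + single i 1 \<in> keys c}" and ?X = "monomial_series (single i 1)"
  have inj: "inj_on (\<lambda>k. k + single i 1) ?K" by (auto intro: inj_onI)
  have fin: "finite ?K"
    by (rule finite_imageD[OF finite_subset[OF _ finite_keys[of c]] inj]) auto
  have "keys (anti_diff i c) \<subseteq> ?K" by (auto simp: in_keys_iff lookup_anti_diff)
  then have "pairing (anti_diff i c) f = (\<Sum>k\<in>?K. lookup c (k + single i 1) * f k)"
    by (simp add: pairing_superset[OF fin] lookup_anti_diff)
  also have "\<dots> = (\<Sum>k\<in>?K. lookup c (k + single i 1) * series_mult ?X f (k + single i 1))"
    using series_mult_monomial[of "single i 1" f] by (simp add: add.commute)
  also have "\<dots> = (\<Sum>j\<in>(\<lambda>k. k + single i 1) ` ?K. lookup c j * series_mult ?X f j)"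
    using inj by (simp add: sum.reindex)
  also have "\<dots> = pairing c (series_mult ?X f)"
    unfolding pairing_def
  proof (rule sum.mono_neutral_left)
    show "\<forall>j\<in>keys c - (\<lambda>k. k + single i 1) ` ?K. lookup c j * series_mult ?X f j = 0"
    proof
      fix j assume j: "j \<in> keys c - (\<lambda>k. k + single i 1) ` ?K"
      then have "\<nexists>l. single i 1 + l = j" by (auto simp: add.commute)
      then show "lookup c j * series_mult ?X f j = 0" by (simp add: series_mult_monomial_0)
    qed
  qed auto
  finally show ?thesis .
qed

text \<open>
  Since \<open>c\<close> sees only finitely many coefficients, killing all monomial multiples of \<open>f\<close> is enough to
  kill every multiple of \<open>f\<close>.
\<close>

lemma pairing_series_mult:
  fixes c :: "'n::finite functional"
  shows "\<exists>L. pairing c (series_mult h f) = (\<Sum>k\<in>L. h k * pairing c (series_mult (monomial_series k) f))"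
proof -
  let ?L = "\<Union>j\<in>keys c. {k. \<exists>l. k + l = j}"
  have "finite ?L" using finite_mindex_summands by auto
  then have "pairing c (series_mult h f)
      = (\<Sum>j\<in>keys c. lookup c j * (\<Sum>k\<in>?L. h k * series_mult (monomial_series k) f j))"
    unfolding pairing_def by (intro sum.cong arg_cong2[of _ _ _ _ "(*)"] series_mult_eq_sum_monomials) auto
  also have "\<dots> = (\<Sum>k\<in>?L. h k * pairing c (series_mult (monomial_series k) f))"
    unfolding pairing_def sum_distrib_left by (subst sum.swap) (simp add: mult_ac)
  finally show ?thesis ..
qed

lemma apply_functional_eq_pairing: "apply_functional a c p = pairing c (lookup (translate a p))"
  by (simp add: apply_functional_def pairing_def diff_symbol_at_eq_lookup_translate)

lemma lookup_translate_0: "lookup (translate a p) 0 = poly_eval p a"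
  by (simp add: lookup_translate poly_eval_def monom_eval_def)

text \<open>
  Unfolding the recursion: each anti-differentiation moves one more variable to the other
  side of the pairing, so the conditions accumulate to one for every monomial multiple of
  every member of the system. At level \<open>0\<close> they hold because the system vanishes at \<open>a\<close>.
\<close>

lemma dual_space_upto_iff:
  assumes "a \<in> zero_set P"
  shows "c \<in> dual_space_upto P a \<alpha> \<longleftrightarrow> (\<forall>j\<in>keys c. mindex_size j \<le> \<alpha>) \<and>
    (\<forall>p\<in>P. \<forall>k. pairing c (series_mult (monomial_series k) (lookup (translate a p))) = 0)"
proof (induction \<alpha> arbitrary: c)
  case 0
  have "pairing c (series_mult (monomial_series k) (lookup (translate a p))) = 0"
    if "p \<in> P" "\<forall>j. j \<noteq> 0 \<longrightarrow> lookup c j = 0" for p k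
  proof -
    have "pairing c (series_mult (monomial_series k) (lookup (translate a p)))
        = lookup c 0 * series_mult (monomial_series k) (lookup (translate a p)) 0"
      using that(2) by (subst pairing_superset[of "{0}"]) (auto simp: in_keys_iff)
    also have "series_mult (monomial_series k) (lookup (translate a p)) 0 = 0"
    proof (cases "k = 0")
      case True
      then show ?thesis
        using series_mult_monomial[of 0 "lookup (translate a p)" 0] that(1) assms
        by (simp add: lookup_translate_0 zero_set_def)
    next
      case False
      then have "\<nexists>l. k + l = 0"
        by (metis add_is_0 mindex_size_add mindex_size_eq_0_iff)
      then show ?thesis by (rule series_mult_monomial_0)
    qed
    finally show ?thesis by simp
  qed
  then show ?case
    unfolding dual_space_upto.simps single_zero_iff by (auto simp: in_keys_iff mindex_size_eq_0_iff)
next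
  case (Suc \<alpha>)
  let ?T = "\<lambda>p. lookup (translate a p)"
  have shift: "pairing (anti_diff i c) (series_mult (monomial_series k) (?T p))
      = pairing c (series_mult (monomial_series (single i 1 + k)) (?T p))" for i k p
    by (simp add: pairing_anti_diff series_mult_assoc[symmetric] series_mult_monomial_monomial)
  have "series_mult (monomial_series 0) (?T p) = ?T p" for p
    using series_mult_monomial[of 0] by (auto simp: fun_eq_iff)
  then have zero: "apply_functional a c p = pairing c (series_mult (monomial_series 0) (?T p))" for p
    by (simp only: apply_functional_eq_pairing)
  have index: "k = 0 \<or> (\<exists>i l. k = single i 1 + l)" for k :: "'a mindex"
  proof (cases "k = 0")
    case False
    then obtain i where "lookup k i \<noteq> 0" by (auto simp: poly_mapping_eq_iff fun_eq_iff)
    then have "k = single i 1 + (k - single i 1)"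
      by (intro poly_mapping_eqI) (auto simp: lookup_add lookup_minus lookup_single when_def)
    then show ?thesis by blast
  qed simp
  have "mindex_size j \<le> \<alpha>"
    if "\<forall>j\<in>keys c. mindex_size j \<le> Suc \<alpha>" "j \<in> keys (anti_diff i c)" for i j
  proof -
    have "j + single i 1 \<in> keys c" using that(2) by (simp add: in_keys_iff lookup_anti_diff)
    moreover have "mindex_size (single i 1) = 1" by (simp add: mindex_size_def lookup_single when_def)
    ultimately show ?thesis using that(1) by (fastforce simp: mindex_size_add)
  qed
  moreover have "(\<forall>p\<in>P. \<forall>k. Q k p) \<longleftrightarrow> (\<forall>p\<in>P. Q 0 p) \<and> (\<forall>i. \<forall>p\<in>P. \<forall>k. Q (single i 1 + k) p)"
    for Q :: "'a mindex \<Rightarrow> 'a cpoly \<Rightarrow> bool"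
    using index by metis
  note this[of "\<lambda>k p. pairing c (series_mult (monomial_series k) (?T p)) = 0"]
  ultimately show ?case
    unfolding dual_space_upto.simps mem_Collect_eq Suc.IH shift zero by blast
qed

text \<open>
  The series all of whose multiples are killed by \<open>c\<close> form an ideal. Once it contains the
  system, it contains the ideal generated by the system.
\<close>

lemma dual_space_eq_annihilator:
  fixes a :: "complex ^ 'n::finite"
  assumes "a \<in> zero_set P"
  shows "dual_space P a = {c. \<forall>f\<in>system_ideal P a. pairing c f = 0}"
proof -
  let ?T = "\<lambda>p. lookup (translate a p)"
  note I = ideal_system_ideal[of P a]
  interpret cring "series_ring :: 'n series ring" by (rule cring_series_ring)
  have T: "?T p \<in> system_ideal P a" if "p \<in> P" for p
    using genideal_self[of "?T ` P"] that convergent_series_lookup unfolding system_ideal_def by auto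
  show ?thesis
  proof (intro equalityI subsetI)
    fix c assume "c \<in> dual_space P a"
    then obtain \<alpha> where "c \<in> dual_space_upto P a \<alpha>" by (auto simp: dual_space_def)
    then have c: "pairing c (series_mult (monomial_series k) (?T p)) = 0" if "p \<in> P" for p k
      using that by (simp add: dual_space_upto_iff[OF assms])
    let ?K = "{f. convergent_series f \<and> (\<forall>h. convergent_series h \<longrightarrow> pairing c (series_mult h f) = 0)}"
    have "ideal ?K series_ring"
    proof (rule ideal_series_ringI)
      show "(\<lambda>m. f m + g m) \<in> ?K" if "f \<in> ?K" "g \<in> ?K" for f g
        using that r_distr[of f g] by (auto simp: convergent_series_add pairing_add_right)
      show "series_mult h f \<in> ?K" if "f \<in> ?K" "convergent_series h" for f h
        using that by (auto simp: convergent_series_mult series_mult_assoc[symmetric])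
      show "(\<lambda>m. 0) \<in> ?K"
        using zero_closed r_null by (auto simp: pairing_zero_right)
    qed auto
    moreover have "?T ` P \<subseteq> ?K"
    proof (rule image_subsetI)
      fix p assume "p \<in> P"
      have "pairing c (series_mult h (?T p)) = 0" for h
        using pairing_series_mult[of c h "?T p"] c[OF \<open>p \<in> P\<close>] by auto
      then show "?T p \<in> ?K" by (simp add: convergent_series_lookup)
    qed
    ultimately have "system_ideal P a \<subseteq> ?K"
      unfolding system_ideal_def by (rule genideal_minimal)
    moreover have "pairing c f = 0" if "f \<in> ?K" for f
      using that convergent_series_const[of 1] by (force simp: series_mult_const)
    ultimately show "c \<in> {c. \<forall>f\<in>system_ideal P a. pairing c f = 0}" by blast
  next
    fix c assume c: "c \<in> {c. \<forall>f\<in>system_ideal P a. pairing c f = 0}"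
    obtain \<alpha> where "\<forall>j\<in>keys c. mindex_size j \<le> \<alpha>"
      using finite_nat_set_iff_bounded_le[of "mindex_size ` keys c"] by auto
    moreover have "pairing c (series_mult (monomial_series k) (?T p)) = 0" if "p \<in> P" for p k
      using c series_ideal_mult[OF I T[OF that] convergent_series_lookup] by blast
    ultimately have "c \<in> dual_space_upto P a \<alpha>" by (simp add: dual_space_upto_iff[OF assms])
    then show "c \<in> dual_space P a" by (auto simp: dual_space_def)
  qed
qed

section \<open>Power series of high order\<close>

text \<open>
  A linear form on finitely many Taylor coefficients is a differential functional.
\<close>

lemma separating_functional:
  fixes I :: "'n::finite series set"
  assumes "ideal I series_ring" "finite B" "\<nexists>u. u \<in> I \<and> (\<forall>j\<in>B. u j = v j)"
  obtains c where "\<And>f. f \<in> I \<Longrightarrow> pairing c f = 0" "pairing c v = 1"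
proof -
  obtain c where c: "\<And>u. u \<in> I \<Longrightarrow> (\<Sum>j\<in>B. c j * u j) = 0" "(\<Sum>j\<in>B. c j * v j) = 1"
    using separating_coefficients[OF assms(2) series_ideal_zero[OF assms(1)] series_ideal_add[OF assms(1)]
        series_ideal_scale[OF assms(1)] assms(3)] by blast
  let ?c = "\<Sum>j\<in>B. single j (c j)"
  have "lookup ?c j = (if j \<in> B then c j else 0)" for j
    using assms(2) by (simp add: lookup_sum lookup_single when_def)
  moreover from this have "keys ?c \<subseteq> B" by (auto simp: in_keys_iff split: if_splits)
  ultimately have "pairing ?c f = (\<Sum>j\<in>B. c j * f j)" for f
    by (simp add: pairing_superset[OF assms(2)])
  with c show ?thesis by (intro that[of ?c]) auto
qed

text \<open>
  The condition on \<open>k\<close> says that no functional that kills \<open>I\<close> has a term of degree \<open>k\<close>. By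
  separation each monomial of degree \<open>k\<close> then agrees up to degree \<open>k\<close> with an element of \<open>I\<close>.
  The difference has order larger than \<open>k\<close>, hence is a combination of monomials of degree \<open>k\<close> with
  coefficients in the maximal ideal, and Nakayama's lemma applies.
\<close>

lemma mem_ideal_of_high_order:
  fixes I :: "'n::finite series set"
  assumes I: "ideal I series_ring"
    and top: "\<And>c j. \<lbrakk>\<And>f. f \<in> I \<Longrightarrow> pairing c f = 0; mindex_size j = k\<rbrakk> \<Longrightarrow> lookup c j = 0"
    and f: "convergent_series f" "\<And>m. mindex_size m < k \<Longrightarrow> f m = 0"
  shows "f \<in> I"
proof -
  interpret cring "series_ring :: 'n series ring" by (rule cring_series_ring)
  let ?L = "{l :: 'n mindex. mindex_size l = k}" and ?J = "{f :: 'n series. convergent_series f \<and> f 0 = 0}"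
  let ?S = "monomial_series ` ?L"
  have finL: "finite ?L" by (rule finite_subset[OF _ finite_mindex_size_le[of k]]) auto
  have S: "?S \<subseteq> carrier series_ring" using convergent_series_lookup by auto
  note JS = ideal_prod_is_ideal[OF ideal_maximal genideal_ideal[OF S]]
  have "?S \<subseteq> I <+>\<^bsub>series_ring\<^esub> ?J \<cdot>\<^bsub>series_ring\<^esub> (Idl\<^bsub>series_ring\<^esub> ?S)"
  proof (rule image_subsetI)
    fix l assume l: "l \<in> ?L"
    have "\<exists>u. u \<in> I \<and> (\<forall>j\<in>{j. mindex_size j \<le> k}. u j = monomial_series l j)"
    proof (rule ccontr)
      assume "\<not> ?thesis"
      then obtain c where "\<And>f. f \<in> I \<Longrightarrow> pairing c f = 0" "pairing c (monomial_series l) = 1"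
        by (rule separating_functional[OF I finite_mindex_size_le]) blast
      with top l show False by (auto simp: pairing_monomial_series)
    qed
    then obtain u where u: "u \<in> I" "\<And>j. mindex_size j \<le> k \<Longrightarrow> u j = monomial_series l j" by blast
    define h where "h = (\<lambda>m. monomial_series l m + - 1 * u m)"
    have h: "convergent_series h"
      unfolding h_def
      by (intro convergent_series_add convergent_series_scale convergent_series_lookup series_ideal_convergent[OF I u(1)])
    have h0: "h m = 0" if "mindex_size m \<le> k" for m using u(2)[OF that] by (simp add: h_def)
    have "h m = 0" if "mindex_size m < k" for m using h0[of m] that by simp
    then obtain g where g: "\<And>l. convergent_series (g l)" "\<And>l. mindex_size l = k \<Longrightarrow> g l 0 = h l"
      "\<And>m. h m = (\<Sum>l\<in>?L. series_mult (monomial_series l) (g l) m)"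
      using divide_by_monomials[OF h, of k] by blast
    have "series_mult (monomial_series l) (g l) \<in> ?J \<cdot>\<^bsub>series_ring\<^esub> (Idl\<^bsub>series_ring\<^esub> ?S)" if "l \<in> ?L" for l
    proof -
      have "monomial_series l \<in> Idl\<^bsub>series_ring\<^esub> ?S" using genideal_self[OF S] that by blast
      moreover have "g l \<in> ?J" using g(1,2)[of l] h0[of l] that by simp
      ultimately show ?thesis
        using ideal_prod.prod[of "g l" ?J _ _ series_ring] series_mult_commute[of "monomial_series l" "g l"]
        by simp
    qed
    then have "h \<in> ?J \<cdot>\<^bsub>series_ring\<^esub> (Idl\<^bsub>series_ring\<^esub> ?S)"
      using series_ideal_sum[OF JS, of ?L "\<lambda>l. series_mult (monomial_series l) (g l)"] by (simp flip: g(3))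
    moreover have "monomial_series l = u \<oplus>\<^bsub>series_ring\<^esub> h" by (simp add: h_def)
    ultimately show "monomial_series l \<in> I <+>\<^bsub>series_ring\<^esub> ?J \<cdot>\<^bsub>series_ring\<^esub> (Idl\<^bsub>series_ring\<^esub> ?S)"
      using u(1) unfolding set_add_def' by blast
  qed
  then have "?S \<subseteq> I"
    using nakayama[OF ideal_maximal _ _ S I] one_minus_maximal_unit finL by blast
  moreover obtain g where g: "\<And>l. convergent_series (g l)"
    "\<And>m. f m = (\<Sum>l\<in>?L. series_mult (monomial_series l) (g l) m)"
    using divide_by_monomials[OF f] by blast
  ultimately have "series_mult (monomial_series l) (g l) \<in> I" if "l \<in> ?L" for l
    using series_ideal_mult[OF I _ g(1)] that by (subst series_mult_commute) blast
  then have "(\<lambda>m. \<Sum>l\<in>?L. series_mult (monomial_series l) (g l) m) \<in> I" by (rule series_ideal_sum[OF I])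
  then show ?thesis by (simp flip: g(2))
qed

section \<open>The dual space paired with the local algebra\<close>

lemma local_algebra_cosets:
  fixes P a
  defines "coset \<equiv> \<lambda>f. system_ideal P a +>\<^bsub>series_ring\<^esub> f"
  shows "carrier (local_algebra P a) = coset ` {f. convergent_series f}"
    and "\<lbrakk>convergent_series f; convergent_series g\<rbrakk> \<Longrightarrow>
      coset f \<oplus>\<^bsub>local_algebra P a\<^esub> coset g = coset (\<lambda>m. f m + g m)"
    and "convergent_series f \<Longrightarrow> b \<odot>\<^bsub>local_algebra P a\<^esub> coset f = coset (\<lambda>m. b * f m)"
    and "f \<in> system_ideal P a \<Longrightarrow> coset f = \<zero>\<^bsub>local_algebra P a\<^esub>"
proof -
  interpret ideal "system_ideal P a" series_ring by (rule ideal_system_ideal)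
  interpret h: ring_hom_cring series_ring "local_ring P a" coset
    unfolding local_ring_def coset_def by (rule rcos_ring_hom_cring[OF cring_series_ring])
  show "carrier (local_algebra P a) = coset ` {f. convergent_series f}"
    by (auto simp: local_algebra_def local_ring_def FactRing_def A_RCOSETS_def' coset_def)
  show "coset f \<oplus>\<^bsub>local_algebra P a\<^esub> coset g = coset (\<lambda>m. f m + g m)"
    if "convergent_series f" "convergent_series g"
    using h.hom_add[of f g] that by (simp add: local_algebra_def)
  show "b \<odot>\<^bsub>local_algebra P a\<^esub> coset f = coset (\<lambda>m. b * f m)" if "convergent_series f"
    using h.hom_mult[of "const_series b" f] that
    by (simp add: local_algebra_def convergent_series_const series_mult_const coset_def)
  show "coset f = \<zero>\<^bsub>local_algebra P a\<^esub>" if "f \<in> system_ideal P a"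
    using a_rcos_zero[OF ideal_axioms that]
    by (simp add: coset_def local_algebra_def local_ring_def FactRing_def)
qed

text \<open>
  The choice of a representative is immaterial for functionals in the dual space, by
  \<open>coset_pairing_coset\<close>.
\<close>

definition coset_pairing :: "'n functional \<Rightarrow> 'n series set \<Rightarrow> complex" where
  "coset_pairing c X = pairing c (SOME f. f \<in> X)"

lemma coset_pairing_coset:
  assumes "a \<in> zero_set P" "c \<in> dual_space P a" "convergent_series f"
  shows "coset_pairing c (system_ideal P a +>\<^bsub>series_ring\<^esub> f) = pairing c f"
proof -
  interpret ideal "system_ideal P a" series_ring by (rule ideal_system_ideal)
  let ?X = "system_ideal P a +>\<^bsub>series_ring\<^esub> f"
  have "pairing c g = pairing c f" if "g \<in> ?X" for g
    using that assms(2) unfolding a_r_coset_def' dual_space_eq_annihilator[OF assms(1)]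
    by (auto simp: pairing_add_right)
  moreover have "f \<in> ?X" using assms(3) by (intro a_rcos_self) simp
  ultimately show ?thesis unfolding coset_pairing_def by (metis someI_ex)
qed

lemma complex_pairing_dual_space:
  assumes "a \<in> zero_set P"
  shows "complex_pairing (functional_space\<lparr>carrier := dual_space P a\<rparr>) (local_algebra P a) coset_pairing"
proof -
  interpret V: vectorspace complex_field "functional_space\<lparr>carrier := dual_space P a\<rparr>"
    by (rule vectorspace_dual_space[OF assms])
  interpret W: vectorspace complex_field "local_algebra P a" by (rule vectorspace_local_algebra)
  note [simp] = local_algebra_cosets coset_pairing_coset[OF assms]
  have closed: "c + d \<in> dual_space P a" "Poly_Mapping.map ((*) b) c \<in> dual_space P a"
    if "c \<in> dual_space P a" "d \<in> dual_space P a" for b c d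
    using that by (auto simp: dual_space_eq_annihilator[OF assms] pairing_add_left pairing_scale_left)
  show ?thesis
  proof unfold_locales
    show "coset_pairing (x \<oplus>\<^bsub>functional_space\<lparr>carrier := dual_space P a\<rparr>\<^esub> y) w
        = coset_pairing x w + coset_pairing y w"
      if "x \<in> carrier (functional_space\<lparr>carrier := dual_space P a\<rparr>)"
        "y \<in> carrier (functional_space\<lparr>carrier := dual_space P a\<rparr>)"
        "w \<in> carrier (local_algebra P a)" for x y w
      using that closed(1) by (auto simp: functional_space_def pairing_add_left)
    show "coset_pairing (b \<odot>\<^bsub>functional_space\<lparr>carrier := dual_space P a\<rparr>\<^esub> x) w = b * coset_pairing x w"
      if "x \<in> carrier (functional_space\<lparr>carrier := dual_space P a\<rparr>)"
        "w \<in> carrier (local_algebra P a)" for b x w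
      using that closed(2) by (auto simp: functional_space_def pairing_scale_left)
  qed (auto simp: convergent_series_add convergent_series_scale pairing_add_right pairing_scale_right)
qed

theorem theorem2:
  fixes P :: "'n::finite cpoly set" and a :: "complex ^ 'n"
  assumes "finite P"
    and "a isolated_in zero_set P"
  shows "multiplicity_at P a = intersection_multiplicity P a"
proof -
  have a: "a \<in> zero_set P" using assms(2) by (simp add: isolated_in_def)
  let ?I = "system_ideal P a" and ?D = "functional_space\<lparr>carrier := dual_space P a\<rparr>"
  let ?coset = "\<lambda>f. ?I +>\<^bsub>series_ring\<^esub> f"
  note I = ideal_system_ideal[of P a]
  interpret complex_pairing ?D "local_algebra P a" coset_pairing
    by (rule complex_pairing_dual_space[OF a])
  have pair: "coset_pairing c (?coset f) = pairing c f" "?coset f \<in> carrier (local_algebra P a)"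
    if "convergent_series f" "c \<in> carrier ?D" for c f
    using that coset_pairing_coset[OF a] by (auto simp: local_algebra_cosets)
  have "multiplicity_at P a \<le> intersection_multiplicity P a"
    unfolding multiplicity_at_def intersection_multiplicity_def
  proof (rule ext_dim_le)
    fix c assume c: "c \<in> carrier ?D" "\<And>X. X \<in> carrier (local_algebra P a) \<Longrightarrow> coset_pairing c X = 0"
    have "lookup c j = 0" for j
      using pair[OF convergent_series_lookup c(1), of "single j 1"] c(2) by (simp add: pairing_monomial_series)
    then show "c = \<zero>\<^bsub>?D\<^esub>" by (intro poly_mapping_eqI) (simp add: functional_space_def)
  qed
  moreover have "intersection_multiplicity P a \<le> multiplicity_at P a"
  proof (cases "V.fin_dim")
    case True
    then obtain A where A: "finite A" "A \<subseteq> carrier ?D" "V.gen_set A" unfolding V.fin_dim_def by blast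
    obtain k where k: "\<And>j. j \<in> (\<Union>c\<in>A. keys c) \<Longrightarrow> mindex_size j < k"
      using finite_nat_set_iff_bounded[of "mindex_size ` (\<Union>c\<in>A. keys c)"] A(1) by auto
    \<comment> \<open>No functional in the dual space has a term of degree \<open>k\<close>, because no generator does.\<close>
    have top: "lookup c j = 0" if "\<And>f. f \<in> ?I \<Longrightarrow> pairing c f = 0" "mindex_size j = k" for c j
    proof -
      have c: "c \<in> carrier ?D" using that(1) by (simp add: dual_space_eq_annihilator[OF a])
      have X: "convergent_series (monomial_series j :: 'n series)" by (rule convergent_series_lookup)
      have "lookup d j = 0" if "d \<in> A" for d
        using k[of j] \<open>mindex_size j = k\<close> that by (auto simp: in_keys_iff)
      then have "coset_pairing d (?coset (monomial_series j)) = 0" if "d \<in> A" for d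
        using pair(1)[OF X] that A(2) by (auto simp: pairing_monomial_series)
      then have "coset_pairing c (?coset (monomial_series j)) = 0"
        using pair_eq_0_of_generators[OF A pair(2)[OF X c] _ c] by blast
      then show ?thesis using pair(1)[OF X c] by (simp add: pairing_monomial_series)
    qed
    show ?thesis
      unfolding multiplicity_at_def intersection_multiplicity_def
    proof (rule complex_pairing.ext_dim_le[OF flipped])
      fix X assume X: "X \<in> carrier (local_algebra P a)" "\<And>c. c \<in> carrier ?D \<Longrightarrow> coset_pairing c X = 0"
      then obtain f where f: "convergent_series f" "X = ?coset f" by (auto simp: local_algebra_cosets)
      \<comment> \<open>A functional that separates \<open>f\<close> from \<open>?I\<close> would lie in the dual space and not kill \<open>X\<close>.\<close>
      have "\<exists>u. u \<in> ?I \<and> (\<forall>j\<in>{j. mindex_size j \<le> k}. u j = f j)"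
      proof (rule ccontr)
        assume "\<not> ?thesis"
        then obtain c where c: "\<And>f. f \<in> ?I \<Longrightarrow> pairing c f = 0" "pairing c f = 1"
          by (rule separating_functional[OF I finite_mindex_size_le]) blast
        then have "c \<in> carrier ?D" by (simp add: dual_space_eq_annihilator[OF a])
        then show False using X(2) f pair(1)[OF f(1)] c(2) by simp
      qed
      then obtain u where u: "u \<in> ?I" "\<And>j. mindex_size j \<le> k \<Longrightarrow> u j = f j" by blast
      have "(\<lambda>m. f m + - 1 * u m) \<in> ?I"
      proof (rule mem_ideal_of_high_order[OF I top])
        show "convergent_series (\<lambda>m. f m + - 1 * u m)"
          by (intro convergent_series_add convergent_series_scale f(1) series_ideal_convergent[OF I u(1)])
      qed (use u(2) in auto)
      from series_ideal_add[OF I this u(1)] have "f \<in> ?I" by simp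
      then show "X = \<zero>\<^bsub>local_algebra P a\<^esub>" unfolding f(2) by (rule local_algebra_cosets)
    qed
  next
    case False
    then show ?thesis by (simp add: multiplicity_at_def ext_dim_def)
  qed
  ultimately show ?thesis by (rule antisym)
qed

end
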